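(* Let $M$ be a compact manifold of dimension greater than or equal to two, with metric $d$, let $F_2$ be the free group on two generators $a,b$, and let $\Phi: F_2\times M\to M$ be an action. If $\Phi$ is $C^0$-stable, then $\Phi$ has the shadowing property.
   Context: Let $G$ be a topological group and $(X,d)$ a metric space. An action of $G$ on $X$ is a continuous map $\Phi:G\times X\to X$ with $\Phi(g_1,\Phi(g_2,x))=\Phi(g_1g_2,x)$ for all $g_1,g_2\in G$, $x\in X$, such that each $\Phi_g:X\to X$, $\Phi_g(x)=\Phi(g,x)$, is a homeomorphism. $Act(G,X)$ denotes the set of actions of $G$ on $X$. For $G=F_2$ (discrete) use the finite symmetric generating set $S=\{a,a^{-1},b,b^{-1}\}$ (for $X$ compact, neither notion below depends on the choice of finite symmetric generating set). $C^0$-stability: for maps $f,g:X\to X$ let $d_{C^0}(f,g)=\sup_{x\in X}d(f(x),g(x))$, and for $\Phi,\widetilde\Phi\in Act(G,X)$ let $d^0_S(\widetilde\Phi,\Phi)=\max_{s\in S}d_{C^0}(\widetilde\Phi_s,\Phi_s)$. The action $\Phi$ is $C^0$-stable if for every $\varepsilon>0$ there exists $\delta>0$ such that for every $\widetilde\Phi\in Act(G,X)$ with $d^0_S(\widetilde\Phi,\Phi)<\delta$ there is a continuous surjective map $h:X\to X$ with $h\circ\widetilde\Phi_g=\Phi_g\circ h$ for every $g\in G$ and $d_{C^0}(h,\mathrm{id})<\varepsilon$. Shadowing property: for $\delta>0$, a family $\{x_g\}_{g\in G}$ of points of $X$ is a $\delta$-pseudotrajectory for $\Phi$ if $d(\Phi_s(x_g),x_{sg})<\delta$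 for all $g\in G$ and all $s\in S$. The action $\Phi$ has the shadowing property if for every $\varepsilon>0$ there exists $\delta>0$ such that for every $\delta$-pseudotrajectory $\{x_g\}_{g\in G}$ there is a point $y\in X$ with $d(x_g,\Phi_g(y))<\varepsilon$ for all $g\in G$. *)

theory Defs
  imports "HOL-Analysis.Analysis" "HOL-Algebra.Group"
begin

subsection \<open>Free groups, as groups of reduced words\<close>

text \<open>The letter \<open>(x, True)\<close> stands for the generator \<open>x\<close>, the letter \<open>(x, False)\<close> for its
  formal inverse.\<close>

type_synonym 'x letter = "'x \<times> bool"

definition inv_letter :: "'x letter \<Rightarrow> 'x letter" where
  "inv_letter l = (fst l, \<not> snd l)"

definition reduced_word :: "'x letter list \<Rightarrow> bool" where
  "reduced_word w \<longleftrightarrow> successively (\<lambda>l k. k \<noteq> inv_letter l) w"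

fun cons_letter :: "'x letter \<Rightarrow> 'x letter list \<Rightarrow> 'x letter list" where
  "cons_letter l [] = [l]"
| "cons_letter l (k # w) = (if k = inv_letter l then w else l # k # w)"

text \<open>For reduced \<open>u\<close> and \<open>v\<close>, \<open>foldr cons_letter u v\<close> is the reduced form of \<open>u @ v\<close>.\<close>

definition free_group :: "'x letter list monoid" where
  "free_group = \<lparr>carrier = {w. reduced_word w}, mult = foldr cons_letter, one = []\<rparr>"

lemma inv_letter_inv_letter [simp]: "inv_letter (inv_letter l) = l"
  by (simp add: inv_letter_def)

lemma inv_letter_neq [simp]: "inv_letter l \<noteq> l" "l \<noteq> inv_letter l"
  by (metis inv_letter_def snd_conv)+

lemma reduced_Nil [simp]: "reduced_word []"
  by (simp add: reduced_word_def)

lemma reduced_ConsD: "reduced_word (l # w) \<Longrightarrow> reduced_word w"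
  by (cases w) (auto simp: reduced_word_def)

lemma reduced_cons_letter: "reduced_word w \<Longrightarrow> reduced_word (cons_letter l w)"
  by (cases w) (auto simp: reduced_word_def intro: reduced_ConsD[unfolded reduced_word_def])

lemma reduced_foldr: "reduced_word v \<Longrightarrow> reduced_word (foldr cons_letter u v)"
  by (induction u) (auto intro: reduced_cons_letter)

lemma cons_letter_cancel: "reduced_word w \<Longrightarrow> cons_letter l (cons_letter (inv_letter l) w) = w"
  by (cases w rule: remdups_adj.cases) (auto simp: reduced_word_def)

lemma cons_letter_cancel': "reduced_word w \<Longrightarrow> cons_letter (inv_letter l) (cons_letter l w) = w"
  using cons_letter_cancel[of w "inv_letter l"] by simp

lemma cons_letter_reduced: "reduced_word (l # w) \<Longrightarrow> cons_letter l w = l # w"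
  by (cases w) (auto simp: reduced_word_def)

lemma foldr_cons_letter_Nil: "reduced_word w \<Longrightarrow> foldr cons_letter w [] = w"
  proof (induction w)
  case (Cons l w)
  then show ?case
    using cons_letter_reduced[OF Cons.prems] reduced_ConsD[OF Cons.prems] by simp
qed simp

lemma foldr_cons_letter:
  "reduced_word w \<Longrightarrow> foldr cons_letter (cons_letter l v) w = cons_letter l (foldr cons_letter v w)"
  by (cases v) (auto simp: cons_letter_cancel reduced_foldr)

lemma foldr_foldr_cons_letter:
  "reduced_word w \<Longrightarrow>
    foldr cons_letter (foldr cons_letter u v) w = foldr cons_letter u (foldr cons_letter v w)"
  by (induction u) (auto simp: foldr_cons_letter)

lemma foldr_inv_cancel:
  "reduced_word w \<Longrightarrow> foldr cons_letter (rev (map inv_letter u)) (foldr cons_letter u w) = w"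
  by (induction u) (auto simp: cons_letter_cancel' reduced_foldr)

lemma group_free_group: "group free_group"
proof (rule groupI)
  fix u :: "'x letter list" assume u: "u \<in> carrier free_group"
  define v where "v = foldr cons_letter (rev (map inv_letter u)) []"
  have "v \<otimes>\<^bsub>free_group\<^esub> u = \<one>\<^bsub>free_group\<^esub>"
    using u foldr_inv_cancel[of "[]" u]
    by (simp add: v_def free_group_def foldr_foldr_cons_letter foldr_cons_letter_Nil)
  moreover have "v \<in> carrier free_group"
    by (simp add: v_def free_group_def reduced_foldr)
  ultimately show "\<exists>v\<in>carrier free_group. v \<otimes>\<^bsub>free_group\<^esub> u = \<one>\<^bsub>free_group\<^esub>"
    by blast
qed (auto simp: free_group_def reduced_foldr foldr_foldr_cons_letter)

datatype two_gens = A | B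

abbreviation F2 :: "two_gens letter list monoid" where
  "F2 \<equiv> free_group"

definition gen_a :: "two_gens letter list" where
  "gen_a = [(A, True)]"

definition gen_b :: "two_gens letter list" where
  "gen_b = [(B, True)]"

definition F2_gens :: "two_gens letter list set" where
  "F2_gens = {gen_a, inv\<^bsub>F2\<^esub> gen_a, gen_b, inv\<^bsub>F2\<^esub> gen_b}"


subsection \<open>Manifolds\<close>

text \<open>Topological manifolds without boundary, not necessarily connected, of dimension
  \<open>DIM('e)\<close>. Being Hausdorff and second countable is not required separately, since the
  definition is only applied to compact metric spaces.\<close>

definition manifold_modelled_on :: "'e::euclidean_space itself \<Rightarrow> 'a::metric_space set \<Rightarrow> bool" where
  "manifold_modelled_on _ M \<longleftrightarrow>
    (\<forall>p\<in>M. \<exists>U. \<exists>V :: 'e set.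
       openin (top_of_set M) U \<and> p \<in> U \<and> open V \<and> U homeomorphic V)"


subsection \<open>Actions of topological groups on metric spaces\<close>

text \<open>The topological group is given by a group \<open>G\<close> and a topology \<open>T\<close> on its carrier. The values
  \<open>\<Phi> g x\<close> matter only for \<open>g \<in> carrier G\<close> and \<open>x \<in> X\<close>.\<close>

definition Act ::
  "('g, 'm) monoid_scheme \<Rightarrow> 'g topology \<Rightarrow> 'a::metric_space set \<Rightarrow> ('g \<Rightarrow> 'a \<Rightarrow> 'a) set" where
  "Act G T X = {\<Phi>.
     continuous_map (prod_topology T (top_of_set X)) (top_of_set X) (\<lambda>(g, x). \<Phi> g x) \<and>
     (\<forall>g\<^sub>1\<in>carrier G. \<forall>g\<^sub>2\<in>carrier G. \<forall>x\<in>X. \<Phi> g\<^sub>1 (\<Phi> g\<^sub>2 x) = \<Phi> (g\<^sub>1 \<otimes>\<^bsub>G\<^esub> g\<^sub>2) x) \<and>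
     (\<forall>g\<in>carrier G. homeomorphic_map (top_of_set X) (top_of_set X) (\<Phi> g))}"

text \<open>Distances take values in \<^typ>\<open>ennreal\<close>, so that the suprema exist for every \<open>X\<close>.\<close>

definition dist_C0 :: "'a::metric_space set \<Rightarrow> ('a \<Rightarrow> 'a) \<Rightarrow> ('a \<Rightarrow> 'a) \<Rightarrow> ennreal" where
  "dist_C0 X f g = (SUP x\<in>X. ennreal (dist (f x) (g x)))"

definition dist_Act ::
  "'g set \<Rightarrow> 'a::metric_space set \<Rightarrow> ('g \<Rightarrow> 'a \<Rightarrow> 'a) \<Rightarrow> ('g \<Rightarrow> 'a \<Rightarrow> 'a) \<Rightarrow> ennreal" where
  "dist_Act S X \<Psi> \<Phi> = Max ((\<lambda>s. dist_C0 X (\<Psi> s) (\<Phi> s)) ` S)"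

definition C0_stable ::
  "('g, 'm) monoid_scheme \<Rightarrow> 'g topology \<Rightarrow> 'g set \<Rightarrow> 'a::metric_space set \<Rightarrow> ('g \<Rightarrow> 'a \<Rightarrow> 'a) \<Rightarrow> bool"
where
  "C0_stable G T S X \<Phi> \<longleftrightarrow>
    (\<forall>\<epsilon>::real. \<epsilon> > 0 \<longrightarrow> (\<exists>\<delta>::real. \<delta> > 0 \<and>
      (\<forall>\<Psi>\<in>Act G T X. dist_Act S X \<Psi> \<Phi> < ennreal \<delta> \<longrightarrow>
        (\<exists>h. continuous_on X h \<and> h ` X = X \<and>
             (\<forall>g\<in>carrier G. \<forall>x\<in>X. h (\<Psi> g x) = \<Phi> g (h x)) \<and>
             dist_C0 X h id < ennreal \<epsilon>))))"

definition pseudotrajectory ::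
  "('g, 'm) monoid_scheme \<Rightarrow> 'g set \<Rightarrow> 'a::metric_space set \<Rightarrow> ('g \<Rightarrow> 'a \<Rightarrow> 'a) \<Rightarrow> real \<Rightarrow>
     ('g \<Rightarrow> 'a) \<Rightarrow> bool" where
  "pseudotrajectory G S X \<Phi> \<delta> x \<longleftrightarrow>
    (\<forall>g\<in>carrier G. x g \<in> X) \<and>
    (\<forall>g\<in>carrier G. \<forall>s\<in>S. dist (\<Phi> s (x g)) (x (s \<otimes>\<^bsub>G\<^esub> g)) < \<delta>)"

definition shadowing ::
  "('g, 'm) monoid_scheme \<Rightarrow> 'g set \<Rightarrow> 'a::metric_space set \<Rightarrow> ('g \<Rightarrow> 'a \<Rightarrow> 'a) \<Rightarrow> bool" where
  "shadowing G S X \<Phi> \<longleftrightarrow>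
    (\<forall>\<epsilon>::real. \<epsilon> > 0 \<longrightarrow> (\<exists>\<delta>::real. \<delta> > 0 \<and>
      (\<forall>x. pseudotrajectory G S X \<Phi> \<delta> x \<longrightarrow>
        (\<exists>y\<in>X. \<forall>g\<in>carrier G. dist (x g) (\<Phi> g y) < \<epsilon>))))"

end

theory Submission
  imports Defs
begin

text \<open>Perturb a pseudotrajectory, restricted to a ball of the free group, so that its points become
  distinct. Since the dimension is at least two, a homeomorphism close to the identity then moves
  \<open>\<Phi>\<^sub>a(x\<^sub>w)\<close> to \<open>x\<^sub>a\<^sub>w\<close> for all relevant \<open>w\<close> at once, and likewise for \<open>b\<close>; composing \<open>\<Phi>\<^sub>a\<close> and \<open>\<Phi>\<^sub>b\<close>
  with these homeomorphisms gives, by freeness, an action \<open>\<Psi>\<close> close to \<open>\<Phi>\<close> that has the finite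
  pseudotrajectory as an exact orbit segment. The semiconjugacy provided by stability maps its base
  point to a point whose \<open>\<Phi>\<close>-orbit shadows on the ball, and compactness passes to the whole group.

  To keep the displacement small however many points are moved, the manifold is covered, at every
  scale, by small cells in a number of colours that does not depend on the scale, cells of
  the same colour being disjoint. Points are moved inside cells one colour at a time, so the total
  displacement is at most the number of colours times the size of a cell.\<close>

subsection \<open>Moving finitely many points inside small cells\<close>


text \<open>The assignment is a map on points rather than an indexed family, which keeps an index
  type out of the definition. Points outside \<open>U\<close> are fixed in the whole type, so
  displacement bounds later hold for every \<open>z\<close>.\<close>

definition movable :: "'a::topological_space set \<Rightarrow> 'a set \<Rightarrow> bool" where
  "movable M U \<longleftrightarrow>
    (\<forall>K \<gamma>. finite K \<and> K \<subseteq> U \<and> inj_on \<gamma> K \<and> \<gamma> ` K \<subseteq> U \<longrightarrow>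
      (\<exists>f g. homeomorphism M M f g \<and> (\<forall>k\<in>K. f k = \<gamma> k) \<and> (\<forall>z. z \<notin> U \<longrightarrow> f z = z)))"

lemma movableE:
  fixes x y :: "'i \<Rightarrow> 'a::topological_space"
  assumes "movable M U" "finite I" "inj_on x I" "inj_on y I" "x ` I \<subseteq> U" "y ` I \<subseteq> U"
  obtains f g where "homeomorphism M M f g" "\<And>i. i \<in> I \<Longrightarrow> f (x i) = y i"
    "\<And>z. z \<notin> U \<Longrightarrow> f z = z"
proof -
  let ?\<gamma> = "\<lambda>p. y (inv_into I x p)"
  have *: "?\<gamma> (x i) = y i" if "i \<in> I" for i
    using that assms(3) by simp
  have "inj_on ?\<gamma> (x ` I)"
    using assms(3,4) by (auto simp: inj_on_def)
  moreover have "?\<gamma> ` x ` I \<subseteq> U"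
    using assms(6) * by auto
  moreover have "finite (x ` I)"
    using assms(2) by simp
  ultimately have "\<exists>f g. homeomorphism M M f g \<and> (\<forall>k\<in>x ` I. f k = ?\<gamma> k) \<and>
      (\<forall>z. z \<notin> U \<longrightarrow> f z = z)"
    using assms(1)[unfolded movable_def, rule_format, of "x ` I" ?\<gamma>] assms(5) by blast
  then show ?thesis
    using that * by auto
qed

lemma continuous_on_chart_extension:
  fixes M :: "'a::metric_space set" and V :: "'e::euclidean_space set"
  assumes hom: "homeomorphism U V \<phi> \<psi>" and U: "openin (top_of_set M) U"
    and K: "compact K" "K \<subseteq> V" and f: "continuous_on V f" "f ` V \<subseteq> V" "\<And>x. x \<notin> K \<Longrightarrow> f x = x"
  shows "continuous_on M (\<lambda>z. if z \<in> U then \<psi> (f (\<phi> z)) else z)" (is "continuous_on M ?F")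
proof -
  have "compact (\<psi> ` K)"
    using hom K by (meson compact_continuous_image continuous_on_subset homeomorphism_cont2)
  then have open2: "openin (top_of_set M) (M - \<psi> ` K)"
    by (metis compact_imp_closed open_Compl openin_open_Int Diff_eq)
  have UM: "U \<subseteq> M"
    using U by (simp add: openin_imp_subset)
  have "\<psi> ` K \<subseteq> U"
    using hom K(2) homeomorphism_image2 by fastforce
  then have M: "M = U \<union> (M - \<psi> ` K)"
    using UM by blast
  have "continuous_on U (\<lambda>z. \<psi> (f (\<phi> z)))"
  proof (rule continuous_on_compose2[of V \<psi> U "\<lambda>z. f (\<phi> z)"])
    show "continuous_on U (\<lambda>z. f (\<phi> z))"
      using continuous_on_compose2[OF f(1) homeomorphism_cont1[OF hom]] homeomorphism_image1[OF hom]
      by simp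
    show "(\<lambda>z. f (\<phi> z)) ` U \<subseteq> V"
      using f(2) homeomorphism_image1[OF hom] by auto
  qed (rule homeomorphism_cont2[OF hom])
  then have 1: "continuous_on U ?F"
    by (simp cong: continuous_on_cong)
  have "?F z = z" if "z \<in> M - \<psi> ` K" for z
  proof (cases "z \<in> U")
    case True
    then have "\<phi> z \<notin> K"
      using that hom by (metis DiffD2 homeomorphism_apply1 imageI)
    then show ?thesis
      using True f(3) hom by (simp add: homeomorphism_apply1)
  qed simp
  then have 2: "continuous_on (M - \<psi> ` K) ?F"
    using continuous_on_cong[of "M - \<psi> ` K" "M - \<psi> ` K" ?F "\<lambda>z. z"] by simp
  show ?thesis
    using continuous_on_Un_local_open[OF _ _ 1 2] U open2 M by simp
qed

text \<open>Transports through the chart the Euclidean fact that finitely many points of a connected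
  open set can be moved independently. This is where dimension at least two enters: on a line the
  order of the points is an obstruction.\<close>

lemma movable_chart:
  fixes M :: "'a::metric_space set" and V :: "'e::euclidean_space set"
  assumes dim: "DIM('e) \<ge> 2" and hom: "homeomorphism U V \<phi> \<psi>"
    and U: "openin (top_of_set M) U"
    and C: "open C" "connected C" "C \<subseteq> K" "compact K" "K \<subseteq> V"
  shows "movable M (\<psi> ` C)"
  unfolding movable_def
proof (intro allI impI, elim conjE)
  fix P \<gamma>
  assume P: "finite P" "P \<subseteq> \<psi> ` C" and \<gamma>: "inj_on \<gamma> P" "\<gamma> ` P \<subseteq> \<psi> ` C"
  show "\<exists>f g. homeomorphism M M f g \<and> (\<forall>k\<in>P. f k = \<gamma> k) \<and> (\<forall>z. z \<notin> \<psi> ` C \<longrightarrow> f z = z)"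
  \<comment> \<open>The Euclidean result asks for \<open>V\<close> inside the affine hull of
    \<open>C\<close>, which is the whole space once the open set \<open>C\<close> is nonempty; a
    point of \<open>P\<close> guarantees this.\<close>
  proof (cases "P = {}")
    case True
    then show ?thesis
      using homeomorphism_ident[of M] by auto
  next
    case False
    have CV: "C \<subseteq> V" and UM: "U \<subseteq> M"
      using C U by (auto simp: openin_imp_subset)
    have \<phi>\<psi>: "\<phi> (\<psi> v) = v" if "v \<in> V" for v
      using hom that by (simp add: homeomorphism_apply2)
    have \<psi>\<phi>: "\<psi> (\<phi> u) = u" if "u \<in> U" for u
      using hom that by (simp add: homeomorphism_apply1)
    have CU: "\<psi> ` C \<subseteq> U"
      using hom CV homeomorphism_image2 by fastforce
    have \<phi>U: "\<phi> u \<in> V" if "u \<in> U" for u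
      using hom that homeomorphism_image1 by fastforce
    have \<psi>V: "\<psi> u \<in> U" if "u \<in> V" for u
      using hom that homeomorphism_image2 by fastforce
    have "C \<noteq> {}"
      using False P by auto
    then have aff: "V \<subseteq> affine hull C"
      by (simp add: affine_hull_open C)
    have 1: "\<phi> p \<in> C \<and> \<phi> (\<gamma> p) \<in> C" if "p \<in> P" for p
    proof -
      obtain u v where "u \<in> C" "p = \<psi> u" "v \<in> C" "\<gamma> p = \<psi> v"
        using \<open>p \<in> P\<close> P \<gamma> by blast
      then show ?thesis
        using \<phi>\<psi> CV by auto
    qed
    have "inj_on \<phi> U"
      by (metis \<psi>\<phi> inj_onI)
    then have 2: "pairwise (\<lambda>i j. \<phi> i \<noteq> \<phi> j \<and> \<phi> (\<gamma> i) \<noteq> \<phi> (\<gamma> j)) P"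
      using P \<gamma> CU unfolding pairwise_def inj_on_def by blast
    have 3: "pairwise (\<lambda>i j. \<phi> i \<noteq> \<phi> j \<and> (\<phi> \<circ> \<gamma>) i \<noteq> (\<phi> \<circ> \<gamma>) j) P"
      using 2 by simp
    have 4: "\<phi> p \<in> C \<and> (\<phi> \<circ> \<gamma>) p \<in> C" if "p \<in> P" for p
      using 1[OF that] by simp
    obtain f g where fg: "homeomorphism V V f g" "\<And>i. i \<in> P \<Longrightarrow> f (\<phi> i) = (\<phi> \<circ> \<gamma>) i"
        "{x. \<not> (f x = x \<and> g x = x)} \<subseteq> C"
    proof (rule homeomorphism_moving_points_exists[where S = C and T = V and K = P and x = \<phi> and y = "\<phi> \<circ> \<gamma>",
          OF dim C(1,2) CV P(1) 4 3 CV aff C(2)])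
      fix f g
      assume "homeomorphism V V f g" "\<And>i. i \<in> P \<Longrightarrow> f (\<phi> i) = (\<phi> \<circ> \<gamma>) i"
        "{x. \<not> (f x = x \<and> g x = x)} \<subseteq> C"
      then show thesis
        by (rule that)
    qed
    have fC: "f x = x" "g x = x" if "x \<notin> C" for x
      using fg(3) that by auto
    have fK: "f x = x" "g x = x" if "x \<notin> K" for x
      using fC that C(3) by auto
    have fV: "f ` V \<subseteq> V" "g ` V \<subseteq> V"
      using fg(1) by (auto simp: homeomorphism_def)
    let ?F = "\<lambda>z. if z \<in> U then \<psi> (f (\<phi> z)) else z"
    let ?G = "\<lambda>z. if z \<in> U then \<psi> (g (\<phi> z)) else z"
    have inv: "?G (?F z) = z" "?F (?G z) = z" for z
      using fg(1) fV \<phi>\<psi> \<psi>\<phi> \<phi>U \<psi>V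
      by (auto simp: image_subset_iff homeomorphism_apply1 homeomorphism_apply2)
    have im: "?F z \<in> M" "?G z \<in> M" if "z \<in> M" for z
    proof -
      have "\<psi> (f (\<phi> z)) \<in> U" "\<psi> (g (\<phi> z)) \<in> U" if "z \<in> U"
        using \<phi>U[OF that] fV by (auto intro: \<psi>V)
      then show "?F z \<in> M" "?G z \<in> M"
        using that UM by auto
    qed
    have "homeomorphism M M ?F ?G"
    proof
      show "continuous_on M ?F"
        using continuous_on_chart_extension[OF hom U C(4,5) _ fV(1) fK(1)] fg(1)
        by (simp add: homeomorphism_cont1)
      show "continuous_on M ?G"
        using continuous_on_chart_extension[OF hom U C(4,5) _ fV(2) fK(2)] fg(1)
        by (simp add: homeomorphism_cont2)
      show "?F ` M \<subseteq> M" "?G ` M \<subseteq> M"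
        using im(1) im(2) by (simp_all only: image_subset_iff) simp_all
    qed (simp_all only: inv)
    moreover have "?F k = \<gamma> k" if "k \<in> P" for k
    proof -
      have "k \<in> U" "\<gamma> k \<in> U"
        using that P \<gamma> CU by blast+
      then show ?thesis
        using fg(2)[OF that] \<psi>\<phi> by simp
    qed
    moreover have "?F z = z" if "z \<notin> \<psi> ` C" for z
    proof (cases "z \<in> U")
      case True
      then have "\<phi> z \<notin> C"
        using that \<psi>\<phi> by (metis imageI)
      then show ?thesis
        using fC \<psi>\<phi> True by simp
    qed simp
    ultimately show ?thesis
      by blast
  qed
qed

text \<open>A homeomorphism supported in one cell leaves all other cells pointwise fixed, so the
  cells can be treated one after another, and each \<open>z\<close> is moved in at most one of
  them.\<close>

lemma move_points_in_finite_disjoint_family: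
  fixes x y :: "'i \<Rightarrow> 'a::topological_space"
  assumes "finite \<U>" "disjoint \<U>" "\<And>U. U \<in> \<U> \<Longrightarrow> movable M U \<and> U \<subseteq> M"
    and "finite I" "inj_on x I" "inj_on y I"
    and "\<And>i. i \<in> I \<Longrightarrow> x i = y i \<or> (\<exists>U\<in>\<U>. x i \<in> U \<and> y i \<in> U)"
  shows "\<exists>f g. homeomorphism M M f g \<and> (\<forall>i\<in>I. f (x i) = y i) \<and>
    (\<forall>z. f z = z \<or> (\<exists>U\<in>\<U>. z \<in> U \<and> f z \<in> U))"
  using assms
proof (induction \<U> arbitrary: x rule: finite_induct)
  case empty
  then show ?case
    using homeomorphism_ident[of M] by auto
next
  case (insert U \<U>)
  have UM: "movable M U" "U \<subseteq> M"
    using insert.prems by auto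
  have disj: "U \<inter> V = {}" if "V \<in> \<U>" for V
    using insert.prems(1) insert.hyps(2) that by (auto simp: pairwise_insert disjnt_def)
  \<comment> \<open>\<open>J\<close> also contains the points of \<open>U\<close> that are already
    at their targets: the homeomorphism of \<open>U\<close> has to be told to keep them in
    place.\<close>
  define J where "J = {i\<in>I. x i \<in> U}"
  have yJ: "y i \<in> U" if "i \<in> J" for i
    using that insert.prems(6)[of i] disj unfolding J_def by auto
  have "finite J" "inj_on x J" "inj_on y J" "x ` J \<subseteq> U" "y ` J \<subseteq> U"
    using insert.prems yJ by (auto simp: J_def inj_on_def)
  then obtain f g where f: "homeomorphism M M f g" "\<And>i. i \<in> J \<Longrightarrow> f (x i) = y i"
    "\<And>z. z \<notin> U \<Longrightarrow> f z = z"
    using movableE[OF UM(1)] by (metis (no_types, lifting))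
  \<comment> \<open>If \<open>f z\<close> left \<open>U\<close> it would be a fixed point, and
    injectivity of \<open>f\<close> would give \<open>f z = z\<close>.\<close>
  have fU: "f z \<in> U" if "z \<in> U" for z
  proof (rule ccontr)
    assume "f z \<notin> U"
    then have "f (f z) = f z"
      by (rule f(3))
    moreover have "z \<in> M" "f z \<in> M"
      using that UM f(1) by (auto simp: homeomorphism_def)
    ultimately have "f z = z"
      using f(1) by (metis homeomorphism_apply1)
    then show False
      using that \<open>f z \<notin> U\<close> by simp
  qed
  define x' where "x' i = (if i \<in> J then y i else x i)" for i
  have x': "f (x i) = x' i" if "i \<in> I" for i
    using f that by (auto simp: x'_def J_def)
  have "inj_on x' I"
  proof (rule inj_onI)
    fix i j assume ij: "i \<in> I" "j \<in> I" "x' i = x' j"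
    have "x' k \<in> U \<longleftrightarrow> k \<in> J" if "k \<in> I" for k
      using yJ that by (auto simp: x'_def J_def)
    then have "i \<in> J \<longleftrightarrow> j \<in> J"
      using ij by metis
    then show "i = j"
      using ij insert.prems(4,5) unfolding x'_def by (metis inj_onD)
  qed
  moreover have "x' i = y i \<or> (\<exists>U\<in>\<U>. x' i \<in> U \<and> y i \<in> U)" if "i \<in> I" for i
    using insert.prems(6)[OF that] that by (auto simp: x'_def J_def)
  moreover have "disjoint \<U>" "\<And>U. U \<in> \<U> \<Longrightarrow> movable M U \<and> U \<subseteq> M"
    using insert.prems by (auto simp: pairwise_insert)
  ultimately obtain f' g' where f': "homeomorphism M M f' g'" "\<forall>i\<in>I. f' (x' i) = y i"
      "\<forall>z. f' z = z \<or> (\<exists>U\<in>\<U>. z \<in> U \<and> f' z \<in> U)"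
    using insert.IH[of x'] insert.prems by blast
  have "homeomorphism M M (f' \<circ> f) (g \<circ> g')"
    using homeomorphism_compose[OF f(1) f'(1)] by simp
  moreover have "\<forall>i\<in>I. (f' \<circ> f) (x i) = y i"
    using x' f'(2) by simp
  moreover have "(f' \<circ> f) z = z \<or> (\<exists>V\<in>insert U \<U>. z \<in> V \<and> (f' \<circ> f) z \<in> V)" for z
  proof (cases "z \<in> U")
    case True
    then have "f' (f z) = f z"
      using fU disj f'(3) by blast
    then show ?thesis
      using fU True by simp
  next
    case False
    then show ?thesis
      using f(3) f'(3) by (metis comp_apply insertI2)
  qed
  ultimately show ?case
    by blast
qed

text \<open>Finitely many points need only finitely many cells, one chosen for each point that has
  to move; the family itself may be infinite.\<close>

lemma move_points_in_disjoint_family: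
  fixes x y :: "'i \<Rightarrow> 'a::topological_space"
  assumes "disjoint \<U>" "\<And>U. U \<in> \<U> \<Longrightarrow> movable M U \<and> U \<subseteq> M"
    and "finite I" "inj_on x I" "inj_on y I"
    and xy: "\<And>i. i \<in> I \<Longrightarrow> x i = y i \<or> (\<exists>U\<in>\<U>. x i \<in> U \<and> y i \<in> U)"
  obtains f g where "homeomorphism M M f g" "\<And>i. i \<in> I \<Longrightarrow> f (x i) = y i"
    "\<And>z. f z = z \<or> (\<exists>U\<in>\<U>. z \<in> U \<and> f z \<in> U)"
proof -
  obtain U where U: "\<And>i. i \<in> I \<Longrightarrow> x i \<noteq> y i \<Longrightarrow> U i \<in> \<U> \<and> x i \<in> U i \<and> y i \<in> U i"
    using xy by metis
  let ?\<V> = "U ` {i\<in>I. x i \<noteq> y i}"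
  have sub: "?\<V> \<subseteq> \<U>"
    using U by blast
  have "\<exists>f g. homeomorphism M M f g \<and> (\<forall>i\<in>I. f (x i) = y i) \<and>
    (\<forall>z. f z = z \<or> (\<exists>U\<in>?\<V>. z \<in> U \<and> f z \<in> U))"
  proof (rule move_points_in_finite_disjoint_family)
    show "disjoint ?\<V>"
      using assms(1) sub pairwise_subset by blast
  qed (use assms U sub in \<open>auto\<close>)
  then obtain f g where "homeomorphism M M f g" "\<forall>i\<in>I. f (x i) = y i"
      and f: "\<forall>z. f z = z \<or> (\<exists>U\<in>?\<V>. z \<in> U \<and> f z \<in> U)"
    by (elim exE conjE)
  moreover have "f z = z \<or> (\<exists>U\<in>\<U>. z \<in> U \<and> f z \<in> U)" for z
    using f[rule_format, of z] sub by (meson subsetD)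
  ultimately show ?thesis
    using that by simp
qed

text \<open>In the round of colour \<open>c\<close>, every point sharing a cell of that colour with
  its target jumps there and the others wait. Cells of one colour are disjoint, so a round displaces
  each \<open>z\<close> by at most \<open>e\<close>, regardless of the number of points.\<close>

lemma move_points_in_coloured_families:
  fixes x y :: "'i \<Rightarrow> 'a::metric_space" and e :: real
  assumes "finite C"
    and "\<And>c. c \<in> C \<Longrightarrow> disjoint (\<U> c)"
    and "\<And>c U. c \<in> C \<Longrightarrow> U \<in> \<U> c \<Longrightarrow> movable M U \<and> U \<subseteq> M \<and> (\<forall>u\<in>U. \<forall>v\<in>U. dist u v \<le> e)"
    and "0 \<le> e"
    and "finite I" "inj_on x I" "inj_on y I"
    and "\<And>i j. i \<in> I \<Longrightarrow> j \<in> I \<Longrightarrow> x i = y j \<Longrightarrow> i = j"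
    and "\<And>i. i \<in> I \<Longrightarrow> x i = y i \<or> (\<exists>c\<in>C. \<exists>U\<in>\<U> c. x i \<in> U \<and> y i \<in> U)"
  shows "\<exists>f g. homeomorphism M M f g \<and> (\<forall>i\<in>I. f (x i) = y i) \<and>
    (\<forall>z. dist (f z) z \<le> card C * e)"
  using assms
proof (induction C arbitrary: x rule: finite_induct)
  case empty
  then show ?case
    using homeomorphism_ident[of M] by auto
next
  case (insert c C)
  let ?P = "\<lambda>i. \<exists>U\<in>\<U> c. x i \<in> U \<and> y i \<in> U"
  define x' where "x' i = (if ?P i then y i else x i)" for i
  \<comment> \<open>A waiting point cannot collide with one that has arrived, since no start is the
    target of a different index.\<close>
  have "inj_on x' I"
    using insert.prems(5,6,7) unfolding inj_on_def x'_def by metis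
  moreover have "disjoint (\<U> c)" "\<And>U. U \<in> \<U> c \<Longrightarrow> movable M U \<and> U \<subseteq> M"
    using insert.prems(1,2) by blast+
  moreover have "x i = x' i \<or> (\<exists>U\<in>\<U> c. x i \<in> U \<and> x' i \<in> U)" for i
    unfolding x'_def by auto
  ultimately obtain f g where f: "homeomorphism M M f g" "\<And>i. i \<in> I \<Longrightarrow> f (x i) = x' i"
    "\<And>z. f z = z \<or> (\<exists>U\<in>\<U> c. z \<in> U \<and> f z \<in> U)"
    using move_points_in_disjoint_family[of "\<U> c" M I x x'] insert.prems(4,5)
    by (metis (no_types, lifting))
  have fz: "dist (f z) z \<le> e" for z
    using f(3)[of z] insert.prems(2)[of c] insert.prems(3) by auto
  have "\<exists>f g. homeomorphism M M f g \<and> (\<forall>i\<in>I. f (x' i) = y i) \<and> (\<forall>z. dist (f z) z \<le> card C * e)"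
  proof (rule insert.IH)
    show "x' i = y i \<or> (\<exists>c\<in>C. \<exists>U\<in>\<U> c. x' i \<in> U \<and> y i \<in> U)" if "i \<in> I" for i
      using insert.prems(8)[OF that] by (auto simp: x'_def)
    show "i = j" if "i \<in> I" "j \<in> I" "x' i = y j" for i j
      using that insert.prems(6,7) unfolding x'_def inj_on_def by metis
    show "movable M U \<and> U \<subseteq> M \<and> (\<forall>u\<in>U. \<forall>v\<in>U. dist u v \<le> e)" if "c \<in> C" "U \<in> \<U> c" for c U
      using insert.prems(2) that by blast
  qed (use insert.prems \<open>inj_on x' I\<close> in auto)
  then obtain f' g' where f': "homeomorphism M M f' g'" "\<forall>i\<in>I. f' (x' i) = y i"
      "\<forall>z. dist (f' z) z \<le> card C * e"
    by blast
  have "homeomorphism M M (f' \<circ> f) (g \<circ> g')"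
    using homeomorphism_compose[OF f(1) f'(1)] by simp
  moreover have "\<forall>i\<in>I. (f' \<circ> f) (x i) = y i"
    using f f'(2) by simp
  moreover have "dist ((f' \<circ> f) z) z \<le> card (insert c C) * e" for z
    using dist_triangle[of "f' (f z)" z "f z"] f'(3)[rule_format, of "f z"] fz[of z] insert.hyps
    by (simp add: algebra_simps)
  ultimately show ?case
    by blast
qed

subsection \<open>Coloured covers of compact manifolds\<close>


text \<open>Cells are labelled by their integer centres. They have width \<open>3/2\<close> times the grid step, so they
  overlap with their neighbours but are disjoint from cells whose centre has the same parities.\<close>

lemma grid_cover:
  fixes b :: real
  assumes "b > 0"
  obtains Q :: "('e::euclidean_space \<Rightarrow> int) \<Rightarrow> 'e set"
  where "\<And>z. open (Q z)" "\<And>z. convex (Q z)"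
    "\<And>z x y. x \<in> Q z \<Longrightarrow> y \<in> Q z \<Longrightarrow> dist x y \<le> b"
    "\<And>x. \<exists>z. x \<in> Q z"
    "\<And>z z'. {i\<in>Basis. odd (z i)} = {i\<in>Basis. odd (z' i)} \<Longrightarrow> Q z \<noteq> Q z' \<Longrightarrow> Q z \<inter> Q z' = {}"
proof -
  \<comment> \<open>\<open>s\<close> is the grid step. Two points of a cell differ by less than
    \<open>3/2 * s\<close>, hence at most \<open>2 * s\<close>, in each coordinate; summing over the
    \<open>DIM('e)\<close> coordinates bounds the distance by \<open>b\<close>.\<close>
  define s where "s = b / (2 * DIM('e))"
  have s: "s > 0"
    using assms by (simp add: s_def)
  define Q :: "('e \<Rightarrow> int) \<Rightarrow> 'e set" where
    "Q z = box (\<Sum>i\<in>Basis. (s * (z i - 3/4)) *\<^sub>R i) (\<Sum>i\<in>Basis. (s * (z i + 3/4)) *\<^sub>R i)" for z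
  have Q: "x \<in> Q z \<longleftrightarrow> (\<forall>i\<in>Basis. \<bar>x \<bullet> i - s * z i\<bar> < 3/4 * s)" for x z
    unfolding Q_def mem_box
  proof (rule ball_cong[OF refl])
    fix i :: 'e
    assume i: "i \<in> Basis"
    have "(\<Sum>j\<in>Basis. (s * (z j - 3/4)) *\<^sub>R j) \<bullet> i = s * z i - 3/4 * s"
      "(\<Sum>j\<in>Basis. (s * (z j + 3/4)) *\<^sub>R j) \<bullet> i = s * z i + 3/4 * s"
      using i by (simp_all only: inner_sum_left_Basis right_diff_distrib distrib_left mult.commute)
    then show "((\<Sum>j\<in>Basis. (s * (z j - 3/4)) *\<^sub>R j) \<bullet> i < x \<bullet> i \<and>
        x \<bullet> i < (\<Sum>j\<in>Basis. (s * (z j + 3/4)) *\<^sub>R j) \<bullet> i) \<longleftrightarrow> \<bar>x \<bullet> i - s * z i\<bar> < 3/4 * s"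
      by (simp only: abs_less_iff) linarith
  qed
  show thesis
  proof (rule that[of Q])
    show "open (Q z)" "convex (Q z)" for z
      by (auto simp: Q_def)
    show "dist x y \<le> b" if "x \<in> Q z" "y \<in> Q z" for x y z
    proof -
      have "\<bar>(x - y) \<bullet> i\<bar> \<le> 2 * s" if i: "i \<in> Basis" for i
      proof -
        have "\<bar>x \<bullet> i - s * z i\<bar> < 3/4 * s" "\<bar>y \<bullet> i - s * z i\<bar> < 3/4 * s"
          using Q \<open>x \<in> Q z\<close> \<open>y \<in> Q z\<close> i by blast+
        then show ?thesis
          using s unfolding inner_diff_left by linarith
      qed
      then have "(\<Sum>i\<in>Basis. \<bar>(x - y) \<bullet> i\<bar>) \<le> DIM('e) * (2 * s)"
        using sum_bounded_above[of Basis] by (metis (no_types, lifting))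
      also have "\<dots> = b"
        by (simp add: s_def)
      finally show ?thesis
        using norm_le_l1[of "x - y"] by (simp add: dist_norm)
    qed
    show "\<exists>z. x \<in> Q z" for x
    proof
      \<comment> \<open>Rounding to the nearest integer leaves an error of at most
        \<open>s/2\<close>, less than the half-width \<open>3/4 * s\<close>.\<close>
      have "\<bar>x \<bullet> i - s * round (x \<bullet> i / s)\<bar> < 3/4 * s" for i
      proof -
        have "\<bar>x \<bullet> i - s * round (x \<bullet> i / s)\<bar> = s * \<bar>of_int (round (x \<bullet> i / s)) - x \<bullet> i / s\<bar>"
        proof -
          have "x \<bullet> i - s * round (x \<bullet> i / s) = s * - (of_int (round (x \<bullet> i / s)) - x \<bullet> i / s)"
            using s by (simp add: right_diff_distrib)
          then show ?thesis
            using s by (simp only: abs_mult abs_minus_cancel abs_of_pos)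
        qed
        also have "\<dots> \<le> s * (1/2)"
          using of_int_round_abs_le s by (intro mult_left_mono) auto
        finally show ?thesis
          using s by simp
      qed
      then show "x \<in> Q (\<lambda>i. round (x \<bullet> i / s))"
        using Q by blast
    qed
    show "Q z \<inter> Q z' = {}"
      if par: "{i\<in>Basis. odd (z i)} = {i\<in>Basis. odd (z' i)}" and ne: "Q z \<noteq> Q z'" for z z'
    proof (rule ccontr)
      assume "Q z \<inter> Q z' \<noteq> {}"
      then obtain x where x: "x \<in> Q z" "x \<in> Q z'"
        by blast
      have "z i = z' i" if i: "i \<in> Basis" for i
      proof (rule ccontr)
        assume "z i \<noteq> z' i"
        moreover have "odd (z i) \<longleftrightarrow> odd (z' i)"
          using par i by blast
        \<comment> \<open>Centres at least two steps apart in one coordinate are separated by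
          \<open>2 * s\<close>, but a common point forces less than \<open>3/2 * s\<close>.\<close>
        ultimately have "\<bar>z i - z' i\<bar> \<ge> 2"
          by presburger
        then have "s * 2 \<le> s * \<bar>real_of_int (z i) - z' i\<bar>"
          using s by (intro mult_left_mono) linarith+
        also have "\<dots> = \<bar>s * z i - s * z' i\<bar>"
          using s by (simp add: abs_mult right_diff_distrib[symmetric])
        also have "\<dots> < 3/2 * s"
        proof -
          have "\<bar>x \<bullet> i - s * z i\<bar> < 3/4 * s" "\<bar>x \<bullet> i - s * z' i\<bar> < 3/4 * s"
            using Q x i by blast+
          then show ?thesis
            by linarith
        qed
        finally show False
          using s by simp
      qed
      \<comment> \<open>The labels agree only on \<open>Basis\<close> and may differ as functions
        elsewhere; for this reason disjointness is claimed for different cells rather than different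
        labels.\<close>
      then have "Q z = Q z'"
        by (auto simp: Q)
      with ne show False
        by simp
    qed
  qed
qed

text \<open>The covered set \<open>W\<close> is separate from \<open>M\<close> so that covers of
  chart pieces, by cells open in all of \<open>M\<close>, can be combined. Cells may reach beyond
  \<open>W\<close>.\<close>

definition coloured_cover :: "'c set \<Rightarrow> real \<Rightarrow> 'a::metric_space set \<Rightarrow> 'a set \<Rightarrow> ('c \<Rightarrow> 'a set set) \<Rightarrow> bool"
  where
  "coloured_cover C e M W \<U> \<longleftrightarrow> W \<subseteq> (\<Union>c\<in>C. \<Union>(\<U> c)) \<and>
    (\<forall>c\<in>C. disjoint (\<U> c) \<and>
      (\<forall>U\<in>\<U> c. openin (top_of_set M) U \<and> movable M U \<and> (\<forall>u\<in>U. \<forall>v\<in>U. dist u v \<le> e)))"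

text \<open>Grid cells are carried into \<open>M\<close> by the chart, coloured by the set of
  coordinates in which the centre is odd. \<open>W\<close> is chosen before \<open>e\<close>: a
  smaller \<open>e\<close> only refines the grid, leaving the piece and its colours
  unchanged.\<close>

lemma local_coloured_cover:
  fixes M :: "'a::metric_space set"
  assumes man: "manifold_modelled_on TYPE('e::euclidean_space) M" and dim: "DIM('e) \<ge> 2"
    and p: "p \<in> M"
  obtains W where "openin (top_of_set M) W" "p \<in> W"
    "\<And>e. e > 0 \<Longrightarrow> \<exists>\<U>. coloured_cover (Pow (Basis :: 'e set)) e M W \<U>"
proof -
  obtain U and V :: "'e set" where U: "openin (top_of_set M) U" "p \<in> U" and V: "open V"
      and "U homeomorphic V"
    using man p unfolding manifold_modelled_on_def by blast
  then obtain \<phi> \<psi> where hom: "homeomorphism U V \<phi> \<psi>"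
    unfolding homeomorphic_def by blast
  have hom': "homeomorphism V U \<psi> \<phi>"
    using hom by (rule homeomorphism_symD)
  have "\<phi> p \<in> V"
    using hom U(2) homeomorphism_image1 by blast
  \<comment> \<open>The closed ball serves as the compact set around all cells and gives uniform
    continuity of \<open>\<psi>\<close>; only the ball of half the radius is covered, so that cells
    meeting it have room.\<close>
  then obtain r where r: "r > 0" "cball (\<phi> p) r \<subseteq> V"
    using V open_contains_cball by blast
  let ?B = "ball (\<phi> p) (r/2)"
  have open_image: "openin (top_of_set M) (\<psi> ` S)" if "open S" "S \<subseteq> V" for S
  proof -
    have "openin (top_of_set V) S"
      using that by (simp add: open_subset)
    then have "openin (top_of_set U) (\<psi> ` S)"
      using homeomorphism_imp_open_map[OF hom'] by blast
    then show ?thesis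
      using U(1) openin_trans by blast
  qed
  show thesis
  proof (rule that[of "\<psi> ` ?B"])
    have "?B \<subseteq> cball (\<phi> p) r"
      using r(1) by auto
    then have "?B \<subseteq> V"
      using r(2) by (rule subset_trans)
    then show "openin (top_of_set M) (\<psi> ` ?B)"
      by (simp add: open_image)
    show "p \<in> \<psi> ` ?B"
      using homeomorphism_apply1[OF hom U(2)] r(1) by (metis centre_in_ball half_gt_zero image_eqI)
    fix e :: real
    assume "e > 0"
    have "uniformly_continuous_on (cball (\<phi> p) r) \<psi>"
      using hom' r(2) by (meson compact_cball compact_uniformly_continuous continuous_on_subset
          homeomorphism_cont1)
    then obtain d where d: "d > 0"
      "\<And>x y. x \<in> cball (\<phi> p) r \<Longrightarrow> y \<in> cball (\<phi> p) r \<Longrightarrow> dist x y < d \<Longrightarrow> dist (\<psi> x) (\<psi> y) < e"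
      unfolding uniformly_continuous_on_def using \<open>e > 0\<close> by metis
    \<comment> \<open>A cell diameter below \<open>d\<close> makes the image in \<open>M\<close>
      small; one of at most \<open>r/2\<close> keeps every cell that meets the half-radius ball
      inside the closed ball.\<close>
    have "min d r / 2 > 0"
      using d r by simp
    then obtain Q :: "('e \<Rightarrow> int) \<Rightarrow> 'e set"
      where Q: "\<And>z. open (Q z)" "\<And>z. convex (Q z)"
        "\<And>z x y. x \<in> Q z \<Longrightarrow> y \<in> Q z \<Longrightarrow> dist x y \<le> min d r / 2"
        "\<And>x. \<exists>z. x \<in> Q z"
        "\<And>z z'. {i\<in>Basis. odd (z i)} = {i\<in>Basis. odd (z' i)} \<Longrightarrow> Q z \<noteq> Q z' \<Longrightarrow> Q z \<inter> Q z' = {}"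
    proof (rule grid_cover)
      fix Q :: "('e \<Rightarrow> int) \<Rightarrow> 'e set"
      assume "\<And>z. open (Q z)" "\<And>z. convex (Q z)"
        "\<And>z x y. x \<in> Q z \<Longrightarrow> y \<in> Q z \<Longrightarrow> dist x y \<le> min d r / 2"
        "\<And>x. \<exists>z. x \<in> Q z"
        "\<And>z z'. {i\<in>Basis. odd (z i)} = {i\<in>Basis. odd (z' i)} \<Longrightarrow> Q z \<noteq> Q z' \<Longrightarrow> Q z \<inter> Q z' = {}"
      then show thesis
        by (rule that)
    qed
    define Z where "Z c = {z. Q z \<inter> ?B \<noteq> {} \<and> c = {i\<in>Basis. odd (z i)}}" for c
    define \<U> where "\<U> c = (\<lambda>z. \<psi> ` Q z) ` Z c" for c
    have sub: "Q z \<subseteq> cball (\<phi> p) r" if z: "z \<in> Z c" for z c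
    proof
      fix x assume x: "x \<in> Q z"
      obtain y where y: "y \<in> Q z" "dist (\<phi> p) y < r/2"
        using z unfolding Z_def by auto
      have "dist (\<phi> p) x \<le> dist (\<phi> p) y + dist y x"
        by (rule dist_triangle)
      also have "\<dots> \<le> r/2 + min d r / 2"
        using y Q(3)[OF y(1) x] by linarith
      finally show "x \<in> cball (\<phi> p) r"
        by simp
    qed
    have cov: "\<psi> ` ?B \<subseteq> (\<Union>c\<in>Pow Basis. \<Union>(\<U> c))"
    proof
      fix w assume "w \<in> \<psi> ` ?B"
      then obtain x where x: "x \<in> ?B" "w = \<psi> x"
        by blast
      obtain z where z: "x \<in> Q z"
        using Q(4) by blast
      then have "z \<in> Z {i\<in>Basis. odd (z i)}"
        using x(1) by (auto simp: Z_def)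
      moreover have "{i\<in>Basis. odd (z i)} \<in> Pow Basis"
        by auto
      ultimately show "w \<in> (\<Union>c\<in>Pow Basis. \<Union>(\<U> c))"
        using x(2) z unfolding \<U>_def by blast
    qed
    have disj: "disjoint (\<U> c)" for c
    proof (rule pairwiseI)
      fix S T assume "S \<in> \<U> c" "T \<in> \<U> c" "S \<noteq> T"
      then obtain z z' where z: "z \<in> Z c" "z' \<in> Z c" "S = \<psi> ` Q z" "T = \<psi> ` Q z'"
        unfolding \<U>_def by blast
      then have "Q z \<inter> Q z' = {}"
        using Q(5)[of z z'] \<open>S \<noteq> T\<close> by (auto simp: Z_def)
      moreover have "inj_on \<psi> V"
        using homeomorphism_apply1[OF hom'] by (metis inj_onI)
      moreover have "Q z \<subseteq> V" "Q z' \<subseteq> V"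
        using sub z r(2) by blast+
      ultimately show "disjnt S T"
        unfolding z disjnt_def by (metis inj_on_image_Int image_empty)
    qed
    have ope: "openin (top_of_set M) (\<psi> ` Q z)" if "z \<in> Z c" for z c
      using open_image[OF Q(1)] sub[OF that] r(2) by blast
    have mov: "movable M (\<psi> ` Q z)" if "z \<in> Z c" for z c
      using movable_chart[OF dim hom U(1) Q(1) convex_connected[OF Q(2)] sub[OF that] compact_cball r(2)] .
    have small: "dist (\<psi> u) (\<psi> v) \<le> e" if "z \<in> Z c" "u \<in> Q z" "v \<in> Q z" for u v z c
    proof -
      have "min d r / 2 < d"
        using d(1) r(1) by linarith
      then have "dist u v < d"
        using Q(3)[OF that(2,3)] by linarith
      then show ?thesis
        using d(2) sub[OF that(1)] that(2,3) by (meson less_eq_real_def subsetD)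
    qed
    have "coloured_cover (Pow (Basis :: 'e set)) e M (\<psi> ` ?B) \<U>"
      unfolding coloured_cover_def
    proof (intro conjI ballI)
      show "openin (top_of_set M) U" "movable M U" if "U \<in> \<U> c" for U c
        using that ope mov unfolding \<U>_def by auto
      show "dist u v \<le> e" if "U \<in> \<U> c" "u \<in> U" "v \<in> U" for U c u v
        using that small unfolding \<U>_def by blast
    qed (rule cov disj)+
    then show "\<exists>\<U>. coloured_cover (Pow (Basis :: 'e set)) e M (\<psi> ` ?B) \<U>"
      by blast
  qed
qed

text \<open>Finitely many chart pieces suffice by compactness. A colour is a pair of a piece and a
  parity class, so cells from different pieces may overlap, and the colour set is fixed before
  \<open>e\<close>.\<close>

lemma compact_manifold_coloured_cover:
  fixes M :: "'a::metric_space set"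
  assumes man: "manifold_modelled_on TYPE('e::euclidean_space) M" and dim: "DIM('e) \<ge> 2"
    and "compact M"
  shows "\<exists>C :: ('a \<times> 'e set) set. finite C \<and> (\<forall>e>0. \<exists>\<U>. coloured_cover C e M M \<U>)"
proof -
  have "\<exists>W. openin (top_of_set M) W \<and> p \<in> W \<and>
      (\<forall>e>0. \<exists>\<U>. coloured_cover (Pow (Basis :: 'e set)) e M W \<U>)" if "p \<in> M" for p
    by (rule local_coloured_cover[OF man dim that]) blast
  then obtain W where W: "\<And>p. p \<in> M \<Longrightarrow> openin (top_of_set M) (W p) \<and> p \<in> W p"
      "\<And>p e. p \<in> M \<Longrightarrow> e > 0 \<Longrightarrow> \<exists>\<U>. coloured_cover (Pow (Basis :: 'e set)) e M (W p) \<U>"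
    by metis
  obtain D where D: "finite D" "D \<subseteq> M" "M \<subseteq> (\<Union>p\<in>D. W p)"
  proof -
    have "\<forall>T\<in>W ` M. openin (top_of_set M) T" "M \<subseteq> \<Union>(W ` M)"
      using W(1) by auto
    then obtain \<D> where "\<D> \<subseteq> W ` M" "finite \<D>" "M \<subseteq> \<Union>\<D>"
      using \<open>compact M\<close> unfolding compact_eq_openin_cover by meson
    then show thesis
      using that by (metis finite_subset_image)
  qed
  show ?thesis
  proof (intro exI[of _ "D \<times> Pow Basis"] conjI allI impI)
    show "finite (D \<times> Pow (Basis :: 'e set))"
      using D(1) by simp
    fix e :: real
    assume "e > 0"
    then have "\<forall>p\<in>D. \<exists>\<U>. coloured_cover (Pow (Basis :: 'e set)) e M (W p) \<U>"
      using W(2) D(2) by blast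
    then obtain \<U> where \<U>: "\<And>p. p \<in> D \<Longrightarrow> coloured_cover (Pow (Basis :: 'e set)) e M (W p) (\<U> p)"
      by metis
    have 1: "W p \<subseteq> (\<Union>c\<in>Pow Basis. \<Union>(\<U> p c))" if "p \<in> D" for p
      using \<U>[OF that] by (simp add: coloured_cover_def)
    have 2: "disjoint (\<U> p c) \<and> (\<forall>U\<in>\<U> p c. openin (top_of_set M) U \<and> movable M U \<and>
        (\<forall>u\<in>U. \<forall>v\<in>U. dist u v \<le> e))" if "p \<in> D" "c \<in> Pow Basis" for p c
      using \<U>[OF that(1)] that(2) unfolding coloured_cover_def by blast
    have "coloured_cover (D \<times> Pow Basis) e M M (\<lambda>c. \<U> (fst c) (snd c))"
      unfolding coloured_cover_def
    proof (rule conjI[OF _ ballI])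
      show "M \<subseteq> (\<Union>c\<in>D \<times> Pow Basis. \<Union>(\<U> (fst c) (snd c)))"
      proof
        fix x assume "x \<in> M"
        then obtain p where p: "p \<in> D" "x \<in> W p"
          using D(3) by blast
        then obtain c where "c \<in> Pow Basis" "x \<in> \<Union>(\<U> p c)"
          using 1 by blast
        with p show "x \<in> (\<Union>c\<in>D \<times> Pow Basis. \<Union>(\<U> (fst c) (snd c)))"
          by (intro UN_I[of "(p, c)"]) auto
      qed
    qed (rule 2, auto)
    then show "\<exists>\<U>. coloured_cover (D \<times> Pow (Basis :: 'e set)) e M M \<U>"
      by blast
  qed
qed

subsection \<open>Moving finitely many points of a compact manifold\<close>


text \<open>The chart maps a small neighbourhood of \<open>p\<close> onto a nonempty open set of a
  Euclidean space, which is infinite, so a finite set cannot exhaust it.\<close>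

lemma manifold_point_near_avoiding_finite:
  fixes M :: "'a::metric_space set"
  assumes man: "manifold_modelled_on TYPE('e::euclidean_space) M"
    and "p \<in> M" "finite F" "\<eta> > 0"
  obtains q where "q \<in> M" "dist q p < \<eta>" "q \<notin> F"
proof -
  obtain U and V :: "'e set" where U: "openin (top_of_set M) U" "p \<in> U" and V: "open V"
      and "U homeomorphic V"
    using man \<open>p \<in> M\<close> unfolding manifold_modelled_on_def by blast
  then obtain \<phi> \<psi> where hom: "homeomorphism U V \<phi> \<psi>"
    unfolding homeomorphic_def by blast
  let ?W = "U \<inter> ball p \<eta>"
  have UM: "U \<subseteq> M"
    using U(1) by (rule openin_imp_subset)
  have "openin (top_of_set U) ?W"
    by (simp add: openin_open_Int)
  then have "openin (top_of_set V) (\<phi> ` ?W)"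
    using homeomorphism_imp_open_map[OF hom] by blast
  then have "open (\<phi> ` ?W)"
    using V openin_open_eq by blast
  moreover have "\<phi> p \<in> \<phi> ` ?W"
    using U(2) \<open>\<eta> > 0\<close> by auto
  ultimately have "infinite (\<phi> ` ?W)"
    using not_open_singleton[of "\<phi> p"] by (metis empty_iff finite_imp_not_open)
  then have "infinite (?W - F)"
    using \<open>finite F\<close> by auto
  then obtain q where "q \<in> ?W - F"
    using infinite_imp_nonempty by blast
  then show thesis
    using that[of q] UM by (auto simp: dist_commute)
qed

lemma manifold_perturb_injective:
  fixes M :: "'a::metric_space set" and x :: "'i \<Rightarrow> 'a"
  assumes man: "manifold_modelled_on TYPE('e::euclidean_space) M"
    and "finite I" "x ` I \<subseteq> M" "finite F" "\<eta> > 0"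
  shows "\<exists>x'. inj_on x' I \<and> x' ` I \<subseteq> M \<and> x' ` I \<inter> F = {} \<and> (\<forall>i\<in>I. dist (x' i) (x i) < \<eta>)"
  using assms(2,3)
proof (induction I rule: finite_induct)
  case (insert k I)
  then obtain x' where x': "inj_on x' I" "x' ` I \<subseteq> M" "x' ` I \<inter> F = {}"
      "\<forall>i\<in>I. dist (x' i) (x i) < \<eta>"
    by auto
  \<comment> \<open>Injectivity comes from avoiding the points already chosen in addition to
    \<open>F\<close>.\<close>
  obtain q where q: "q \<in> M" "dist q (x k) < \<eta>" "q \<notin> F \<union> x' ` I"
    using manifold_point_near_avoiding_finite[OF man, of "x k" "F \<union> x' ` I" \<eta>] insert assms by auto
  define w where "w = x'(k := q)"
  have w: "w k = q" "\<And>i. i \<in> I \<Longrightarrow> w i = x' i"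
    using insert.hyps by (auto simp: w_def)
  then have im: "w ` I = x' ` I" and "inj_on w I"
    using x'(1) by (auto simp: inj_on_def)
  then have "inj_on w (insert k I)"
    using q(3) w(1) by auto
  moreover have "w ` insert k I = insert q (x' ` I)"
    using im w(1) by simp
  moreover have "\<forall>i\<in>insert k I. dist (w i) (x i) < \<eta>"
    using x'(4) q(2) w by simp
  ultimately show ?case
    using x' q by (intro exI[of _ w]) auto
qed simp

text \<open>Take \<delta> to be a Lebesgue number of the cover: a point and its target at distance
  less than \<delta> then lie in a common cell.\<close>

lemma coloured_cover_moves_points:
  fixes M :: "'a::metric_space set" and e :: real
  assumes cov: "coloured_cover C e M M \<U>" and "finite C" "compact M" "e \<ge> 0"
  shows "\<exists>\<delta>>0. \<forall>(I::'i set) x y. finite I \<and> inj_on x I \<and> inj_on y I \<and> x ` I \<subseteq> M \<and> y ` I \<subseteq> M \<and>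
      (\<forall>i\<in>I. dist (x i) (y i) < \<delta>) \<and> (\<forall>i\<in>I. \<forall>j\<in>I. x i = y j \<longrightarrow> i = j) \<longrightarrow>
      (\<exists>f g. homeomorphism M M f g \<and> (\<forall>i\<in>I. f (x i) = y i) \<and> (\<forall>z. dist (f z) z \<le> card C * e))"
proof -
  let ?\<W> = "\<Union>c\<in>C. \<U> c"
  have ope: "openin (top_of_set M) U" if "U \<in> ?\<W>" for U
    using cov that unfolding coloured_cover_def by blast
  \<comment> \<open>The cells are open only relative to \<open>M\<close>; the Lebesgue number is
    obtained from ambient open sets that cut them out.\<close>
  define \<G> where "\<G> = {G. open G \<and> M \<inter> G \<in> ?\<W>}"
  have "M \<subseteq> \<Union>\<G>"
  proof
    fix z assume "z \<in> M"
    then obtain U where U: "U \<in> ?\<W>" "z \<in> U"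
      using cov unfolding coloured_cover_def by blast
    then obtain G where "open G" "U = M \<inter> G"
      using ope by (auto simp: openin_open)
    then show "z \<in> \<Union>\<G>"
      using U unfolding \<G>_def by blast
  qed
  moreover have "open G" if "G \<in> \<G>" for G
    using that unfolding \<G>_def by blast
  ultimately obtain \<delta> where \<delta>: "\<delta> > 0" "\<And>z. z \<in> M \<Longrightarrow> \<exists>G\<in>\<G>. ball z \<delta> \<subseteq> G"
    using Heine_Borel_lemma[OF \<open>compact M\<close>, of \<G>] by metis
  show ?thesis
  proof (intro exI[of _ \<delta>] conjI allI impI; (elim conjE)?)
    fix I :: "'i set" and x y
    assume I: "finite I" "inj_on x I" "inj_on y I" "x ` I \<subseteq> M" "y ` I \<subseteq> M"
      and near: "\<forall>i\<in>I. dist (x i) (y i) < \<delta>" and disj: "\<forall>i\<in>I. \<forall>j\<in>I. x i = y j \<longrightarrow> i = j"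
    show "\<exists>f g. homeomorphism M M f g \<and> (\<forall>i\<in>I. f (x i) = y i) \<and> (\<forall>z. dist (f z) z \<le> card C * e)"
    proof (rule move_points_in_coloured_families[where \<U> = \<U>])
      show "disjoint (\<U> c)" if "c \<in> C" for c
        using cov that unfolding coloured_cover_def by blast
      show "movable M U \<and> U \<subseteq> M \<and> (\<forall>u\<in>U. \<forall>v\<in>U. dist u v \<le> e)" if "c \<in> C" "U \<in> \<U> c" for c U
        using cov that openin_imp_subset unfolding coloured_cover_def by blast
      show "i = j" if "i \<in> I" "j \<in> I" "x i = y j" for i j
        using disj that by blast
      show "x i = y i \<or> (\<exists>c\<in>C. \<exists>U\<in>\<U> c. x i \<in> U \<and> y i \<in> U)" if "i \<in> I" for i
      proof -
        have "x i \<in> M" "y i \<in> M" "dist (x i) (y i) < \<delta>"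
          using I near that by auto
        moreover obtain G where "G \<in> \<G>" "ball (x i) \<delta> \<subseteq> G"
          using \<delta>(2)[OF \<open>x i \<in> M\<close>] by blast
        ultimately have "x i \<in> M \<inter> G" "y i \<in> M \<inter> G" "M \<inter> G \<in> ?\<W>"
          using \<delta>(1) by (auto simp: \<G>_def subset_iff)
        then show ?thesis
          by blast
      qed
    qed (use assms(2,4) I in auto)
  qed (rule \<delta>(1))
qed

text \<open>The order of choices is the point: \<delta> depends on \<eta> alone and serves finite
  families of every size, because the displacement is bounded through the number of colours.\<close>

proposition compact_manifold_moves_points:
  fixes M :: "'a::metric_space set"
  assumes "compact M" and man: "manifold_modelled_on TYPE('e::euclidean_space) M"
    and dim: "DIM('e) \<ge> 2" and "\<eta> > 0"
  obtains \<delta> where "\<delta> > 0"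
    "\<And>(I::'i set) x y. finite I \<Longrightarrow> inj_on x I \<Longrightarrow> inj_on y I \<Longrightarrow> x ` I \<subseteq> M \<Longrightarrow> y ` I \<subseteq> M \<Longrightarrow>
      (\<And>i. i \<in> I \<Longrightarrow> dist (x i) (y i) < \<delta>) \<Longrightarrow>
      \<exists>f g. homeomorphism M M f g \<and> (\<forall>i\<in>I. f (x i) = y i) \<and> (\<forall>z. dist (f z) z < \<eta>)"
proof -
  obtain C :: "('a \<times> 'e set) set"
    where C: "finite C" "\<And>e. e > 0 \<Longrightarrow> \<exists>\<U>. coloured_cover C e M M \<U>"
    using compact_manifold_coloured_cover[OF man dim \<open>compact M\<close>] by metis
  \<comment> \<open>Two passes each displace by at most \<open>card C * e\<close>, in total
    \<open>\<eta> - e < \<eta>\<close>; the summand 1 gives strictness and a nonzero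
    denominator.\<close>
  define e where "e = \<eta> / (2 * card C + 1)"
  have "e > 0"
    using \<open>\<eta> > 0\<close> by (simp add: e_def)
  have "e * (2 * card C + 1) = \<eta>"
    by (simp add: e_def add_pos_nonneg)
  then have e: "2 * (card C * e) < \<eta>"
    using \<open>e > 0\<close> by (simp add: algebra_simps)
  obtain \<U> where \<U>: "coloured_cover C e M M \<U>"
    using C(2)[OF \<open>e > 0\<close>] by blast
  obtain \<delta> where \<delta>: "\<delta> > 0" "\<forall>(I::'i set) x y. finite I \<and> inj_on x I \<and> inj_on y I \<and> x ` I \<subseteq> M \<and> y ` I \<subseteq> M \<and>
      (\<forall>i\<in>I. dist (x i) (y i) < \<delta>) \<and> (\<forall>i\<in>I. \<forall>j\<in>I. x i = y j \<longrightarrow> i = j) \<longrightarrow>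
      (\<exists>f g. homeomorphism M M f g \<and> (\<forall>i\<in>I. f (x i) = y i) \<and> (\<forall>z. dist (f z) z \<le> card C * e))"
    using coloured_cover_moves_points[OF \<U> C(1) \<open>compact M\<close> less_imp_le[OF \<open>e > 0\<close>], where 'i = 'i]
    by (elim exE conjE) (rule that)
  \<comment> \<open>Halving \<delta> leaves room for the detour: start and intermediate point are
    within \<open>\<delta>/2\<close>, hence intermediate point and target within \<delta>.\<close>
  show thesis
  proof (rule that[of "\<delta>/2"])
    show "\<delta>/2 > 0"
      using \<delta>(1) by simp
    fix I :: "'i set" and x y
    assume I: "finite I" "inj_on x I" "inj_on y I" "x ` I \<subseteq> M" "y ` I \<subseteq> M"
      and near: "\<And>i. i \<in> I \<Longrightarrow> dist (x i) (y i) < \<delta>/2"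
    \<comment> \<open>A target may coincide with the start of another point; the detour through fresh points avoids collisions.\<close>
    obtain w where w: "inj_on w I" "w ` I \<subseteq> M" "w ` I \<inter> (x ` I \<union> y ` I) = {}"
        "\<forall>i\<in>I. dist (w i) (x i) < \<delta>/2"
      using manifold_perturb_injective[OF man I(1,4), of "x ` I \<union> y ` I" "\<delta>/2"] I \<delta>(1) by auto
    have xw: "dist (x i) (w i) < \<delta>" if "i \<in> I" for i
    proof -
      have "dist (w i) (x i) < \<delta>/2"
        using w(4) that by blast
      then show ?thesis
        using \<delta>(1) by (simp add: dist_commute)
    qed
    have wy: "dist (w i) (y i) < \<delta>" if "i \<in> I" for i
    proof -
      have "dist (w i) (x i) < \<delta>/2"
        using w(4) that by blast
      then show ?thesis
        using near[OF that] dist_triangle[of "w i" "y i" "x i"] by linarith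
    qed
    have ne: "x i \<noteq> w j" "w i \<noteq> y j" if "i \<in> I" "j \<in> I" for i j
      using w(3) that by (metis Int_iff UnI1 UnI2 empty_iff imageI)+
    have "finite I \<and> inj_on x I \<and> inj_on w I \<and> x ` I \<subseteq> M \<and> w ` I \<subseteq> M \<and>
        (\<forall>i\<in>I. dist (x i) (w i) < \<delta>) \<and> (\<forall>i\<in>I. \<forall>j\<in>I. x i = w j \<longrightarrow> i = j)"
      using I w(1,2) xw ne(1) by blast
    then obtain f g where f: "homeomorphism M M f g" "\<forall>i\<in>I. f (x i) = w i"
        "\<forall>z. dist (f z) z \<le> card C * e"
      by (rule \<delta>(2)[THEN spec[of _ I], THEN spec[of _ x], THEN spec[of _ w], THEN mp, elim_format])
        (elim exE conjE, rule that)
    have "finite I \<and> inj_on w I \<and> inj_on y I \<and> w ` I \<subseteq> M \<and> y ` I \<subseteq> M \<and>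
        (\<forall>i\<in>I. dist (w i) (y i) < \<delta>) \<and> (\<forall>i\<in>I. \<forall>j\<in>I. w i = y j \<longrightarrow> i = j)"
      using I w(1,2) wy ne(2) by blast
    then obtain f' g' where f': "homeomorphism M M f' g'" "\<forall>i\<in>I. f' (w i) = y i"
        "\<forall>z. dist (f' z) z \<le> card C * e"
      by (rule \<delta>(2)[THEN spec[of _ I], THEN spec[of _ w], THEN spec[of _ y], THEN mp, elim_format])
        (elim exE conjE, rule that)
    have "homeomorphism M M (f' \<circ> f) (g \<circ> g')"
      using homeomorphism_compose[OF f(1) f'(1)] by simp
    moreover have "\<forall>i\<in>I. (f' \<circ> f) (x i) = y i"
      using f(2) f'(2) by simp
    moreover have "dist ((f' \<circ> f) z) z < \<eta>" for z
      using dist_triangle[of "f' (f z)" z "f z"] f(3)[rule_format, of z] f'(3)[rule_format, of "f z"] e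
      by simp
    ultimately show "\<exists>f g. homeomorphism M M f g \<and> (\<forall>i\<in>I. f (x i) = y i) \<and> (\<forall>z. dist (f z) z < \<eta>)"
      by blast
  qed
qed

subsection \<open>Actions of free groups\<close>


text \<open>The preimage of an open set is a union of slices \<open>{g} \<times> V\<close> with
  \<open>V\<close> open, and singletons are open in the discrete factor.\<close>

lemma continuous_map_prod_discrete:
  assumes "\<And>g. g \<in> D \<Longrightarrow> continuous_map X Y (f g)"
  shows "continuous_map (prod_topology (discrete_topology D) X) Y (\<lambda>(g, x). f g x)"
  unfolding continuous_map_def
proof (intro conjI allI impI)
  show "(\<lambda>(g, x). f g x) \<in> topspace (prod_topology (discrete_topology D) X) \<rightarrow> topspace Y"
    using assms by (auto simp: continuous_map_def)
  fix U assume U: "openin Y U"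
  have "{p \<in> topspace (prod_topology (discrete_topology D) X). (\<lambda>(g, x). f g x) p \<in> U}
      = (\<Union>g\<in>D. {g} \<times> {x \<in> topspace X. f g x \<in> U})"
    by auto
  moreover have "openin (prod_topology (discrete_topology D) X) ({g} \<times> {x \<in> topspace X. f g x \<in> U})"
    if "g \<in> D" for g
    using that U assms by (auto simp: openin_prod_Times_iff continuous_map_def)
  ultimately show "openin (prod_topology (discrete_topology D) X)
      {p \<in> topspace (prod_topology (discrete_topology D) X). (\<lambda>(g, x). f g x) p \<in> U}"
    by auto
qed

lemma foldr_in_carrier:
  assumes "\<And>l x. x \<in> M \<Longrightarrow> H l x \<in> M" and "x \<in> M"
  shows "foldr H w x \<in> M"
  using assms by (induction w) auto

text \<open>Whenever \<open>cons_letter\<close> cancels \<open>l\<close> against a leading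
  \<open>inv_letter l\<close>, the corresponding maps cancel as well.\<close>

lemma foldr_cons_letter_action:
  assumes H: "\<And>l x. x \<in> M \<Longrightarrow> H l x \<in> M" "\<And>l x. x \<in> M \<Longrightarrow> H l (H (inv_letter l) x) = x"
    and "x \<in> M"
  shows "foldr H (cons_letter l w) x = H l (foldr H w x)"
  using assms foldr_in_carrier[of M H x] by (cases w) auto

lemma foldr_mult_action:
  assumes H: "\<And>l x. x \<in> M \<Longrightarrow> H l x \<in> M" "\<And>l x. x \<in> M \<Longrightarrow> H l (H (inv_letter l) x) = x"
    and "x \<in> M"
  shows "foldr H (foldr cons_letter u v) x = foldr H u (foldr H v x)"
  using foldr_cons_letter_action[of M H, OF assms] by (induction u) auto

text \<open>This is where freeness of the group enters.\<close>

lemma letter_homeomorphisms_extend_to_action: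
  fixes H :: "'x letter \<Rightarrow> 'a::metric_space \<Rightarrow> 'a"
  assumes hom: "\<And>l. homeomorphic_map (top_of_set M) (top_of_set M) (H l)"
    and inv: "\<And>l x. x \<in> M \<Longrightarrow> H l (H (inv_letter l) x) = x"
  shows "foldr H \<in> Act free_group (discrete_topology (carrier free_group)) M"
proof -
  have HM: "H l x \<in> M" if "x \<in> M" for l x
    using homeomorphic_imp_surjective_map[OF hom[of l]] that by auto
  have homw: "homeomorphic_map (top_of_set M) (top_of_set M) (foldr H w)" for w
  proof (induction w)
    case Nil
    then show ?case
      by (simp add: homeomorphic_map_id[unfolded id_def])
  next
    case (Cons l w)
    have "homeomorphic_map (top_of_set M) (top_of_set M) (H l \<circ> foldr H w)"
      by (rule homeomorphic_map_compose[OF Cons.IH hom])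
    then show ?case
      by (simp add: comp_def)
  qed
  have "foldr H u (foldr H v x) = foldr H (u \<otimes>\<^bsub>free_group\<^esub> v) x" if "x \<in> M" for u v x
    using foldr_mult_action[of M H, OF HM inv that] by (simp add: free_group_def)
  moreover have "continuous_map (prod_topology (discrete_topology (carrier free_group)) (top_of_set M))
      (top_of_set M) (\<lambda>(w, x). foldr H w x)"
    by (rule continuous_map_prod_discrete) (rule homeomorphic_imp_continuous_map[OF homw])
  ultimately show ?thesis
    unfolding Act_def using homw by blast
qed

section \<open>Elementary consequences of the action axioms\<close>

context
  fixes G :: "('g, 'm) monoid_scheme" and T :: "'g topology" and M :: "'a::metric_space set"
    and \<Phi> :: "'g \<Rightarrow> 'a \<Rightarrow> 'a"
  assumes \<Phi>: "\<Phi> \<in> Act G T M"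
begin

lemma Act_homeomorphic_map:
  "g \<in> carrier G \<Longrightarrow> homeomorphic_map (top_of_set M) (top_of_set M) (\<Phi> g)"
  using \<Phi> by (simp add: Act_def)

lemma Act_continuous_on: "g \<in> carrier G \<Longrightarrow> continuous_on M (\<Phi> g)"
  using Act_homeomorphic_map[of g] homeomorphic_imp_continuous_map continuous_map_subtopology_eu
  by fastforce

lemma Act_image: "g \<in> carrier G \<Longrightarrow> \<Phi> g ` M = M"
  using homeomorphic_imp_surjective_map[OF Act_homeomorphic_map] by simp

lemma Act_closed: "g \<in> carrier G \<Longrightarrow> x \<in> M \<Longrightarrow> \<Phi> g x \<in> M"
  using Act_image by blast

lemma Act_inj_on: "g \<in> carrier G \<Longrightarrow> inj_on (\<Phi> g) M"
  using homeomorphic_imp_injective_map[OF Act_homeomorphic_map] by simp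

lemma Act_mult:
  "g \<in> carrier G \<Longrightarrow> g' \<in> carrier G \<Longrightarrow> x \<in> M \<Longrightarrow> \<Phi> g (\<Phi> g' x) = \<Phi> (g \<otimes>\<^bsub>G\<^esub> g') x"
  using \<Phi> by (simp add: Act_def)

lemma Act_one: 
  assumes "monoid G" "x \<in> M"
  shows "\<Phi> \<one>\<^bsub>G\<^esub> x = x"
proof -
  interpret monoid G by fact
  have "\<Phi> \<one>\<^bsub>G\<^esub> (\<Phi> \<one>\<^bsub>G\<^esub> x) = \<Phi> \<one>\<^bsub>G\<^esub> x"
    using Act_mult[of "\<one>\<^bsub>G\<^esub>" "\<one>\<^bsub>G\<^esub>"] assms(2) by simp
  then show ?thesis
    using Act_inj_on[of "\<one>\<^bsub>G\<^esub>"] Act_closed[of "\<one>\<^bsub>G\<^esub>"] assms(2) by (simp add: inj_on_eq_iff)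
qed

end

lemma letter_in_free_group [simp]: "[l] \<in> carrier free_group"
  by (simp add: free_group_def reduced_word_def)

lemma letter_mult_free_group [simp]: "[l] \<otimes>\<^bsub>free_group\<^esub> w = cons_letter l w"
  by (simp add: free_group_def)

lemma Act_inv_letter:
  assumes \<Phi>: "\<Phi> \<in> Act free_group T M" and x: "x \<in> M"
  shows "\<Phi> [l] (\<Phi> [inv_letter l] x) = x"
proof -
  have "\<Phi> [l] (\<Phi> [inv_letter l] x) = \<Phi> \<one>\<^bsub>free_group\<^esub> x"
    using Act_mult[OF \<Phi>, of "[l]" "[inv_letter l]"] x
    by (simp add: free_group_def reduced_word_def)
  then show ?thesis
    using Act_one[OF \<Phi> _ x] group_free_group group.is_monoid by metis
qed

lemma equicontinuous_letters:
  fixes \<Phi> :: "'x letter list \<Rightarrow> 'a::metric_space \<Rightarrow> 'a"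
  assumes "compact M" and \<Phi>: "\<Phi> \<in> Act free_group T M" and fin: "finite (UNIV :: 'x letter set)"
    and "c > 0" "c' > 0"
  obtains d where "d > 0" "d \<le> c'"
    "\<And>l x y. x \<in> M \<Longrightarrow> y \<in> M \<Longrightarrow> dist x y < d \<Longrightarrow> dist (\<Phi> [l] x) (\<Phi> [l] y) < c"
proof -
  have "\<exists>d>0. \<forall>x\<in>M. \<forall>y\<in>M. dist x y < d \<longrightarrow> dist (\<Phi> [l] x) (\<Phi> [l] y) < c" for l
  proof -
    have "uniformly_continuous_on M (\<Phi> [l])"
      using Act_continuous_on[OF \<Phi>] \<open>compact M\<close> by (simp add: compact_uniformly_continuous)
    then show ?thesis
      using \<open>c > 0\<close> unfolding uniformly_continuous_on_def by (metis dist_commute)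
  qed
  then obtain d where d: "\<And>l. d l > 0"
      "\<And>l x y. x \<in> M \<Longrightarrow> y \<in> M \<Longrightarrow> dist x y < d l \<Longrightarrow> dist (\<Phi> [l] x) (\<Phi> [l] y) < c"
    by metis
  \<comment> \<open>A common modulus exists because there are finitely many letters; including
    \<open>c'\<close> builds in a further smallness requirement of the caller.\<close>
  let ?d = "Min (insert c' (range d))"
  have fin': "finite (range d)"
    using fin by simp
  have "?d > 0"
    using fin' d(1) \<open>c' > 0\<close> by (subst Min_gr_iff) auto
  moreover have "?d \<le> c'" "?d \<le> d l" for l
    using fin' by (intro Min_le; simp)+
  ultimately show thesis
    using that[of ?d] d(2) by (meson order_less_le_trans)
qed

section \<open>Uniform distance and passage to the limit\<close>

lemma dist_C0_lessD:
  assumes "dist_C0 M f g < ennreal e" "x \<in> M"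
  shows "dist (f x) (g x) < e"
proof -
  have "ennreal (dist (f x) (g x)) \<le> dist_C0 M f g"
    unfolding dist_C0_def using assms(2) by (rule SUP_upper)
  then have "ennreal (dist (f x) (g x)) < ennreal e"
    using assms(1) by (rule le_less_trans)
  then show ?thesis
    by (simp add: ennreal_less_iff)
qed

lemma dist_C0_lessI:
  assumes "\<And>x. x \<in> M \<Longrightarrow> dist (f x) (g x) \<le> e" "0 \<le> e" "e < e'"
  shows "dist_C0 M f g < ennreal e'"
proof -
  have "dist_C0 M f g \<le> ennreal e"
    unfolding dist_C0_def using assms(1) by (intro SUP_least ennreal_leI)
  also have "\<dots> < ennreal e'"
    using assms(2,3) by (simp add: ennreal_less_iff)
  finally show ?thesis .
qed

text \<open>A limit of a subsequence of the finite-stage points works: for fixed \<open>g\<close>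
  the bound holds from some stage on, as \<open>K\<close> increases, and survives the limit by
  continuity of \<open>\<Phi> g\<close>. A bound \<open>< e\<close> would only survive as
  \<open>\<le> e\<close>, hence the slack \<open>e < e'\<close>.\<close>

lemma shadowing_point_from_finite_approximations:
  fixes x :: "'g \<Rightarrow> 'a::metric_space" and K :: "nat \<Rightarrow> 'g set"
  assumes "compact M" and \<Phi>: "\<Phi> \<in> Act G T M" and "e < e'"
    and K: "\<And>g. g \<in> carrier G \<Longrightarrow> \<exists>n. g \<in> K n" "mono K"
    and fin: "\<And>n. \<exists>y\<in>M. \<forall>g\<in>carrier G \<inter> K n. dist (x g) (\<Phi> g y) \<le> e"
  shows "\<exists>y\<in>M. \<forall>g\<in>carrier G. dist (x g) (\<Phi> g y) < e'"
proof -
  obtain y where y: "\<And>n. y n \<in> M" "\<And>n g. g \<in> carrier G \<Longrightarrow> g \<in> K n \<Longrightarrow> dist (x g) (\<Phi> g (y n)) \<le> e"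
    using fin by (metis IntI)
  obtain z r where z: "z \<in> M" "strict_mono r" "(y \<circ> r) \<longlonglongrightarrow> z"
    using \<open>compact M\<close>[unfolded compact_def, rule_format, of y] y(1) by blast
  have "dist (x g) (\<Phi> g z) < e'" if g: "g \<in> carrier G" for g
  proof -
    obtain n where n: "g \<in> K n"
      using K(1)[OF g] by blast
    have lim: "(\<lambda>k. \<Phi> g ((y \<circ> r) k)) \<longlonglongrightarrow> \<Phi> g z"
      using continuous_on_tendsto_compose[OF Act_continuous_on[OF \<Phi> g] z(3) z(1)] y(1) by simp
    have "dist (x g) (\<Phi> g ((y \<circ> r) k)) \<le> e" if "k \<ge> n" for k
    proof -
      have "n \<le> r k"
        using seq_suble[OF z(2), of k] that by simp
      then have "g \<in> K (r k)"
        using n K(2) by (auto dest: monoD)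
      then show ?thesis
        using y(2)[OF g] by simp
    qed
    then have "\<forall>\<^sub>F k in sequentially. dist (x g) (\<Phi> g ((y \<circ> r) k)) \<le> e"
      by (auto simp: eventually_sequentially)
    then have "dist (x g) (\<Phi> g z) \<le> e"
      using tendsto_upperbound[OF tendsto_dist[OF tendsto_const lim]] by simp
    then show ?thesis
      using \<open>e < e'\<close> by simp
  qed
  then show ?thesis
    using z(1) by blast
qed

section \<open>Generators as one-letter words\<close>

lemma inv_letter_free_group: "inv\<^bsub>free_group\<^esub> [l] = [inv_letter l]"
proof -
  interpret group free_group
    by (rule group_free_group)
  show ?thesis
    by (rule inv_equality) (simp_all, simp add: free_group_def)
qed

lemma F2_gens_eq: "F2_gens = range (\<lambda>l. [l])"
proof -
  have "UNIV = {(A, True), (A, False), (B, True), (B, False)}"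
  proof -
    have "l \<in> {(A, True), (A, False), (B, True), (B, False)}" for l
      by (cases l; cases "fst l"; cases "snd l") auto
    then show ?thesis
      by blast
  qed
  then have "range (\<lambda>l :: two_gens letter. [l]) = (\<lambda>l. [l]) ` {(A, True), (A, False), (B, True), (B, False)}"
    by metis
  then show ?thesis
    by (auto simp: F2_gens_def gen_a_def gen_b_def inv_letter_free_group inv_letter_def)
qed

lemma finite_two_gens_letters: "finite (UNIV :: two_gens letter set)"
proof -
  have "(UNIV :: two_gens set) = {A, B}"
    using two_gens.exhaust by auto
  then have "finite (UNIV :: two_gens set)"
    by (metis finite.emptyI finite_insert)
  then show ?thesis
    by (simp add: finite_prod)
qed

subsection \<open>From stability to shadowing\<close>


text \<open>The constants are chosen in the order \<open>\<delta>0\<close> (stability), \<eta> (size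
  of the modification), \<open>\<delta>1\<close> (distance of points to be moved), \<rho>
  (perturbation to distinct points). None depends on \<open>n\<close>, so one \<delta> serves balls
  of all radii.\<close>

lemma C0_stable_finite_shadowing:
  fixes M :: "'a::metric_space set" and \<Phi> :: "'x letter list \<Rightarrow> 'a \<Rightarrow> 'a"
  assumes S: "S = range (\<lambda>l. [l])" and "compact M" and man: "manifold_modelled_on TYPE('e::euclidean_space) M"
    and dim: "DIM('e) \<ge> 2" and fin: "finite (UNIV :: 'x letter set)"
    and \<Phi>: "\<Phi> \<in> Act free_group (discrete_topology (carrier free_group)) M"
    and stable: "C0_stable free_group (discrete_topology (carrier free_group)) S M \<Phi>"
    and "\<epsilon> > 0"
  shows "\<exists>\<delta>>0. \<forall>x. pseudotrajectory free_group S M \<Phi> \<delta> x \<longrightarrow>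
    (\<forall>n. \<exists>y\<in>M. \<forall>w\<in>carrier free_group \<inter> {w. length w \<le> n}. dist (x w) (\<Phi> w y) \<le> \<epsilon>)"
proof -
  let ?T = "discrete_topology (carrier (free_group :: 'x letter list monoid))"
  have e2: "\<epsilon>/2 > 0"
    using \<open>\<epsilon> > 0\<close> by simp
  obtain \<delta>0 where \<delta>0: "\<delta>0 > 0"
    and ex_h: "\<forall>\<Psi>\<in>Act free_group ?T M. dist_Act S M \<Psi> \<Phi> < ennreal \<delta>0 \<longrightarrow>
        (\<exists>h. continuous_on M h \<and> h ` M = M \<and>
             (\<forall>g\<in>carrier free_group. \<forall>x\<in>M. h (\<Psi> g x) = \<Phi> g (h x)) \<and>
             dist_C0 M h id < ennreal (\<epsilon>/2))"
    using stable[unfolded C0_stable_def, THEN spec, THEN mp, OF e2] by (elim exE conjE) (rule that)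
  have half: "\<delta>0/2 > 0"
    using \<delta>0 by simp
  \<comment> \<open>Generators are modified after applying \<open>\<Phi>\<close>, where a
    displacement \<eta> counts directly; inverse letters are modified before, where
    \<open>\<Phi> [l]\<close> may enlarge it. Hence both conditions on \<eta>.\<close>
  obtain \<eta> where \<eta>: "\<eta> > 0" "\<eta> \<le> \<delta>0/2"
    "\<And>l x y. x \<in> M \<Longrightarrow> y \<in> M \<Longrightarrow> dist x y < \<eta> \<Longrightarrow> dist (\<Phi> [l] x) (\<Phi> [l] y) < \<delta>0/2"
    by (rule equicontinuous_letters[OF \<open>compact M\<close> \<Phi> fin half half]) (rule that)
  obtain \<delta>1 where \<delta>1: "\<delta>1 > 0" and move:
    "\<And>(I::'x letter list set) x y. finite I \<Longrightarrow> inj_on x I \<Longrightarrow> inj_on y I \<Longrightarrow> x ` I \<subseteq> M \<Longrightarrow> y ` I \<subseteq> M \<Longrightarrow>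
      (\<And>i. i \<in> I \<Longrightarrow> dist (x i) (y i) < \<delta>1) \<Longrightarrow>
      \<exists>f g. homeomorphism M M f g \<and> (\<forall>i\<in>I. f (x i) = y i) \<and> (\<forall>z. dist (f z) z < \<eta>)"
  proof (rule compact_manifold_moves_points[OF \<open>compact M\<close> man dim \<eta>(1)])
    fix \<delta>
    assume "\<delta> > 0" "\<And>(I::'x letter list set) x y. finite I \<Longrightarrow> inj_on x I \<Longrightarrow> inj_on y I \<Longrightarrow>
      x ` I \<subseteq> M \<Longrightarrow> y ` I \<subseteq> M \<Longrightarrow> (\<And>i. i \<in> I \<Longrightarrow> dist (x i) (y i) < \<delta>) \<Longrightarrow>
      \<exists>f g. homeomorphism M M f g \<and> (\<forall>i\<in>I. f (x i) = y i) \<and> (\<forall>z. dist (f z) z < \<eta>)"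
    then show thesis
      by (rule that)
  qed
  \<comment> \<open>From \<open>\<Phi> [l] (x' w)\<close> to \<open>x' (cons_letter l w)\<close>
    there are three errors: the perturbation at \<open>w\<close> carried by
    \<open>\<Phi> [l]\<close>, the pseudotrajectory step, and the perturbation at the new word. The
    bound \<open>\<epsilon>/2\<close> is for the final estimate.\<close>
  have third: "\<delta>1/3 > 0" "min (\<delta>1/3) (\<epsilon>/2) > 0"
    using \<delta>1 \<open>\<epsilon> > 0\<close> by simp_all
  obtain \<rho> where \<rho>: "\<rho> > 0" "\<rho> \<le> min (\<delta>1/3) (\<epsilon>/2)"
    "\<And>l x y. x \<in> M \<Longrightarrow> y \<in> M \<Longrightarrow> dist x y < \<rho> \<Longrightarrow> dist (\<Phi> [l] x) (\<Phi> [l] y) < \<delta>1/3"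
    by (rule equicontinuous_letters[OF \<open>compact M\<close> \<Phi> fin third]) (rule that)
  have "\<exists>y\<in>M. \<forall>w\<in>carrier free_group \<inter> {w. length w \<le> n}. dist (x w) (\<Phi> w y) \<le> \<epsilon>"
    if x: "pseudotrajectory free_group S M \<Phi> (\<delta>1/3) x" for x n
  proof -
    define F where "F = carrier free_group \<inter> {w :: 'x letter list. length w \<le> n}"
    have "finite F"
      using finite_subset[OF _ finite_lists_length_le[OF fin, of n]] by (auto simp: F_def)
    have Fred: "reduced_word w" if "w \<in> F" for w
      using that by (simp add: F_def free_group_def)
    have xM: "x w \<in> M" if "w \<in> F" for w
      using x that by (auto simp: F_def pseudotrajectory_def)
    have xstep: "dist (\<Phi> [l] (x w)) (x (cons_letter l w)) < \<delta>1/3" if "w \<in> F" for l w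
      using x that unfolding pseudotrajectory_def S F_def
      by (metis IntD1 letter_mult_free_group rangeI)
    obtain x' where x': "inj_on x' F" "x' ` F \<subseteq> M" "\<forall>w\<in>F. dist (x' w) (x w) < \<rho>"
      using manifold_perturb_injective[OF man \<open>finite F\<close> _ finite.emptyI \<rho>(1), of x] xM by blast
    have x'M: "x' w \<in> M" if "w \<in> F" for w
      using x'(2) that by blast
    \<comment> \<open>Words whose step by \<open>l\<close> stays in the ball; only these transitions
      have to become exact.\<close>
    define I where "I l = {w \<in> F. cons_letter l w \<in> F}" for l :: "'x letter"
    have IF: "I l \<subseteq> F" for l
      by (auto simp: I_def)
    have "\<exists>f g. homeomorphism M M f g \<and>
        (\<forall>w\<in>I l. f (\<Phi> [l] (x' w)) = x' (cons_letter l w)) \<and> (\<forall>z. dist (f z) z < \<eta>)" for l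
    proof (rule move)
      show "finite (I l)"
        using \<open>finite F\<close> IF finite_subset by blast
      show "inj_on (\<lambda>w. \<Phi> [l] (x' w)) (I l)"
        using Act_inj_on[OF \<Phi>, of "[l]"] x'(1) x'M IF
        by (intro inj_onI) (metis inj_onD letter_in_free_group subsetD)
      show "inj_on (\<lambda>w. x' (cons_letter l w)) (I l)"
      proof (rule inj_onI)
        fix u v assume uv: "u \<in> I l" "v \<in> I l" "x' (cons_letter l u) = x' (cons_letter l v)"
        \<comment> \<open>Cancelling \<open>l\<close> on the left recovers \<open>u\<close> and
          \<open>v\<close>, as both are reduced.\<close>
        then have "cons_letter l u = cons_letter l v"
          using x'(1) by (auto simp: I_def inj_on_def)
        then show "u = v"
          using uv(1,2) IF Fred cons_letter_cancel' by (metis subsetD)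
      qed
      show "(\<lambda>w. \<Phi> [l] (x' w)) ` I l \<subseteq> M"
        using Act_closed[OF \<Phi>, of "[l]"] x'M IF[of l] by auto
      show "(\<lambda>w. x' (cons_letter l w)) ` I l \<subseteq> M"
        using x'M by (auto simp: I_def)
      show "dist (\<Phi> [l] (x' w)) (x' (cons_letter l w)) < \<delta>1" if w: "w \<in> I l" for w
      proof -
        have F: "w \<in> F" "cons_letter l w \<in> F"
          using w by (auto simp: I_def)
        then have "dist (x' w) (x w) < \<rho>" "dist (x (cons_letter l w)) (x' (cons_letter l w)) < \<rho>"
          using x'(3) by (auto simp: dist_commute)
        moreover from this have "dist (\<Phi> [l] (x' w)) (\<Phi> [l] (x w)) < \<delta>1/3"
          using \<rho>(3) x'M xM F by blast
        moreover note xstep[OF F(1), of l] \<rho>(2)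
          dist_triangle[of "\<Phi> [l] (x' w)" "x' (cons_letter l w)" "\<Phi> [l] (x w)"]
          dist_triangle[of "\<Phi> [l] (x w)" "x' (cons_letter l w)" "x (cons_letter l w)"]
        ultimately show ?thesis
          by linarith
      qed
    qed
    then obtain f g where f: "\<And>l. homeomorphism M M (f l) (g l)"
        "\<And>l w. w \<in> I l \<Longrightarrow> f l (\<Phi> [l] (x' w)) = x' (cons_letter l w)" "\<And>l z. dist (f l z) z < \<eta>"
      by metis
    have fM: "f l z \<in> M" "g l z \<in> M" "g l (f l z) = z" "f l (g l z) = z" if "z \<in> M" for l z
      using f(1)[of l] that by (auto simp: homeomorphism_def)
    have gz: "dist (g l z) z < \<eta>" if "z \<in> M" for l z
      using f(3)[of l "g l z"] fM(4)[OF that] by (simp add: dist_commute)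
    have f_hom: "homeomorphic_map (top_of_set M) (top_of_set M) (f l)"
      "homeomorphic_map (top_of_set M) (top_of_set M) (g l)" for l
    proof -
      have "homeomorphic_maps (top_of_set M) (top_of_set M) (f l) (g l)"
        using f(1)[of l] by (auto simp: homeomorphic_maps_def homeomorphism_def)
      then show "homeomorphic_map (top_of_set M) (top_of_set M) (f l)"
        "homeomorphic_map (top_of_set M) (top_of_set M) (g l)"
        by (auto simp: homeomorphic_maps_map)
    qed
    \<comment> \<open>Only the generators are modified freely; on an inverse letter \<open>H\<close>
      has to be the inverse of
      \<open>f (inv_letter l) \<circ> \<Phi> [inv_letter l]\<close>.\<close>
    define H where "H l = (if snd l then f l \<circ> \<Phi> [l] else \<Phi> [l] \<circ> g (inv_letter l))" for l
    have \<Phi>M: "\<Phi> [l] z \<in> M" if "z \<in> M" for l z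
      using Act_closed[OF \<Phi>] that by simp
    have \<Phi>inv: "\<Phi> [l] (\<Phi> [inv_letter l] z) = z" "\<Phi> [inv_letter l] (\<Phi> [l] z) = z" if "z \<in> M" for l z
      using Act_inv_letter[OF \<Phi> that, of l] Act_inv_letter[OF \<Phi> that, of "inv_letter l"] by simp_all
    have snd_inv: "snd (inv_letter l) \<longleftrightarrow> \<not> snd l" for l :: "'x letter"
      by (simp add: inv_letter_def)
    have \<Psi>: "foldr H \<in> Act free_group ?T M"
    proof (rule letter_homeomorphisms_extend_to_action)
      show "homeomorphic_map (top_of_set M) (top_of_set M) (H l)" for l
        using homeomorphic_map_compose[OF Act_homeomorphic_map[OF \<Phi>] f_hom(1)[of l], of "[l]"]
          homeomorphic_map_compose[OF f_hom(2)[of "inv_letter l"] Act_homeomorphic_map[OF \<Phi>], of "[l]"]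
        by (simp add: H_def)
      show "H l (H (inv_letter l) z) = z" if "z \<in> M" for l z
        using that by (simp add: H_def snd_inv fM \<Phi>M \<Phi>inv)
    qed
    have "dist (H l z) (\<Phi> [l] z) \<le> \<delta>0/2" if "z \<in> M" for l z
    proof (cases "snd l")
      case True
      then show ?thesis
        using f(3)[of l "\<Phi> [l] z"] \<eta>(2) by (simp add: H_def)
    next
      case False
      then show ?thesis
        using \<eta>(3)[OF fM(2)[OF that] that gz[OF that]] by (simp add: H_def less_imp_le)
    qed
    then have "dist_C0 M (foldr H [l]) (\<Phi> [l]) < ennreal \<delta>0" for l
      using \<delta>0 by (intro dist_C0_lessI[of M _ _ "\<delta>0/2"]) auto
    then have "dist_Act S M (foldr H) \<Phi> < ennreal \<delta>0"
      unfolding dist_Act_def S using fin by (subst Max_less_iff) auto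
    with ex_h \<Psi> obtain h where h: "h ` M = M"
        "\<forall>w\<in>carrier free_group. \<forall>z\<in>M. h (foldr H w z) = \<Phi> w (h z)"
        "dist_C0 M h id < ennreal (\<epsilon>/2)"
      by (metis (no_types, lifting))
    have Hx': "H l (x' w) = x' (cons_letter l w)" if w: "w \<in> I l" for l w
    proof (cases "snd l")
      case True
      then show ?thesis
        using f(2)[OF w] by (simp add: H_def)
    next
      case False
      \<comment> \<open>For an inverse letter the transition is read backwards: the generator
        \<open>inv_letter l\<close> takes \<open>?v\<close> to \<open>w\<close>, and its exact step
        is inverted.\<close>
      let ?v = "cons_letter l w"
      have F: "w \<in> F" "?v \<in> F" "cons_letter (inv_letter l) ?v = w"
        using w Fred cons_letter_cancel'[of w l] by (simp_all add: I_def)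
      then have "f (inv_letter l) (\<Phi> [inv_letter l] (x' ?v)) = x' w"
        using f(2)[of ?v "inv_letter l"] by (simp add: I_def)
      then have "g (inv_letter l) (x' w) = \<Phi> [inv_letter l] (x' ?v)"
        using fM(3)[OF \<Phi>M[OF x'M[OF F(2)]]] by metis
      then show ?thesis
        using False \<Phi>inv(1)[OF x'M[OF F(2)]] by (simp add: H_def)
    qed
    \<comment> \<open>Balls of reduced words are closed under dropping the first letter, so the
      orbit of \<open>x' []\<close> uses only transitions inside the ball.\<close>
    have track: "foldr H w (x' []) = x' w" if "w \<in> F" for w
      using that
    proof (induction w)
      case (Cons l w)
      have red: "reduced_word (l # w)"
        using Fred Cons.prems by blast
      then have w: "w \<in> F" "cons_letter l w = l # w"
        using Cons.prems reduced_ConsD[OF red] cons_letter_reduced[OF red]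
        by (simp_all add: F_def free_group_def)
      then show ?case
        using Cons Hx'[of w l] by (simp add: I_def)
    qed simp
    have "[] \<in> F"
      by (simp add: F_def free_group_def)
    show ?thesis
    \<comment> \<open>By the semiconjugacy the \<open>\<Phi>\<close>-orbit of
      \<open>h (x' [])\<close> is the image under \<open>h\<close> of the exact orbit
      \<open>x' w\<close>. Closeness of \<open>h\<close> to the identity and of \<open>x'\<close> to
      \<open>x\<close> contribute \<open>\<epsilon>/2\<close> each.\<close>
    proof (intro bexI[of _ "h (x' [])"] ballI)
      show "h (x' []) \<in> M"
        using h(1) x'M[OF \<open>[] \<in> F\<close>] by blast
      fix w :: "'x letter list"
      assume "w \<in> carrier free_group \<inter> {w. length w \<le> n}"
      then have w: "w \<in> F"
        by (simp add: F_def)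
      then have "\<Phi> w (h (x' [])) = h (x' w)"
        using h(2)[THEN bspec, THEN bspec, of w "x' []"] x'M[OF \<open>[] \<in> F\<close>] track by (simp add: F_def)
      moreover have "dist (h (x' w)) (x' w) < \<epsilon>/2"
        using dist_C0_lessD[OF h(3) x'M[OF w]] by simp
      moreover have "dist (x' w) (x w) < \<epsilon>/2"
        using x'(3) w \<rho>(2) by force
      ultimately show "dist (x w) (\<Phi> w (h (x' []))) \<le> \<epsilon>"
        using dist_triangle[of "h (x' w)" "x w" "x' w"] by (simp add: dist_commute)
    qed
  qed
  then show ?thesis
    using third(1) by blast
qed

text \<open>The argument works for any finite alphabet with the one-letter words as generating set;
  balls of growing radius exhaust the group and compactness yields one shadowing point.\<close>

theorem C0_stable_imp_shadowing_free_group: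
  fixes M :: "'a::metric_space set" and \<Phi> :: "'x letter list \<Rightarrow> 'a \<Rightarrow> 'a"
  assumes S: "S = range (\<lambda>l. [l])" and "compact M" and man: "manifold_modelled_on TYPE('e::euclidean_space) M"
    and dim: "DIM('e) \<ge> 2" and fin: "finite (UNIV :: 'x letter set)"
    and \<Phi>: "\<Phi> \<in> Act free_group (discrete_topology (carrier free_group)) M"
    and stable: "C0_stable free_group (discrete_topology (carrier free_group)) S M \<Phi>"
  shows "shadowing free_group S M \<Phi>"
  unfolding shadowing_def
proof (intro allI impI)
  fix \<epsilon> :: real
  assume "\<epsilon> > 0"
  then have "\<epsilon>/2 > 0" "\<epsilon>/2 < \<epsilon>"
    by simp_all
  obtain \<delta> where \<delta>: "\<delta> > 0" "\<forall>x. pseudotrajectory free_group S M \<Phi> \<delta> x \<longrightarrow>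
    (\<forall>n. \<exists>y\<in>M. \<forall>w\<in>carrier free_group \<inter> {w. length w \<le> n}. dist (x w) (\<Phi> w y) \<le> \<epsilon>/2)"
    using C0_stable_finite_shadowing[OF S \<open>compact M\<close> man dim fin \<Phi> stable \<open>\<epsilon>/2 > 0\<close>]
    by (elim exE conjE) (rule that)
  have "\<exists>y\<in>M. \<forall>g\<in>carrier free_group. dist (x g) (\<Phi> g y) < \<epsilon>"
    if "pseudotrajectory free_group S M \<Phi> \<delta> x" for x
  proof (rule shadowing_point_from_finite_approximations[OF \<open>compact M\<close> \<Phi> \<open>\<epsilon>/2 < \<epsilon>\<close>])
    show "\<exists>y\<in>M. \<forall>w\<in>carrier free_group \<inter> {w. length w \<le> n}. dist (x w) (\<Phi> w y) \<le> \<epsilon>/2" for n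
      using \<delta>(2) that by blast
    show "mono (\<lambda>n. {w :: 'x letter list. length w \<le> n})"
      by (auto simp: mono_def)
  qed auto
  then show "\<exists>\<delta>>0. \<forall>x. pseudotrajectory free_group S M \<Phi> \<delta> x \<longrightarrow>
      (\<exists>y\<in>M. \<forall>g\<in>carrier free_group. dist (x g) (\<Phi> g y) < \<epsilon>)"
    using \<delta>(1) by blast
qed

theorem theoremA:
  fixes M :: "'a::metric_space set"
    and \<Phi> :: "two_gens letter list \<Rightarrow> 'a \<Rightarrow> 'a"
  assumes "compact M"
    and "manifold_modelled_on TYPE('e::euclidean_space) M"
    and "DIM('e) \<ge> 2"
    and "\<Phi> \<in> Act F2 (discrete_topology (carrier F2)) M"
    and "C0_stable F2 (discrete_topology (carrier F2)) F2_gens M \<Phi>"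
  shows "shadowing F2 F2_gens M \<Phi>"
  using C0_stable_imp_shadowing_free_group[OF F2_gens_eq assms(1-3) finite_two_gens_letters assms(4,5)] .

end
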